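(* Let $\{\mathbf Z^{(n)}\}_{n\ge0}$ be a linear-fractional multi-type Bienaym\'e-Galton-Watson process with parameters $(\mathbf H,\mathbf g,m)$, starting from a single particle, whose mean matrix $\mathbf M=\mathbf H+m\mathbf H\mathbf 1^{\mathrm t}\mathbf g$ is irreducible and aperiodic, and assume $\beta<\infty$. Suppose that $\rho>1$ (the supercritical positively recurrent case). Then, as $n\to\infty$, $$\mathbb P(\mathbf Z^{(n)}\ne\mathbf 0)\to(\rho-1)(1+m)^{-1}\beta\,\mathbf u^{\mathrm t},$$ where $\mathbb P(\mathbf Z^{(n)}\ne\mathbf 0)$ denotes the column vector with elements $\mathbb P(\mathbf Z^{(n)}\ne\mathbf 0\mid\mathbf Z^{(0)}=\mathbf e_i)$, $i\ge1$, and the convergence is component-wise. Furthermore, for any vector $\mathbf w=(w_1,w_2,\ldots)$ with bounded components ($\sup_{j\ge1}|w_j|<\infty$) and $\mathbf v\mathbf w^{\mathrm t}>0$, and for every $i\ge1$, $$\mathbb P\big(\mathbf Z^{(n)}\mathbf w^{\mathrm t}>\rho^nx\mid\mathbf Z^{(n)}\ne\mathbf 0,\mathbf Z^{(0)}=\mathbf e_i\big)\to e^{-x(\rho-1)/c_w},\qquad x>0,$$ where $c_w=(1+m)\beta^{-1}\mathbf v\mathbf w^{\mathrm t}$.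
   Context: Vectors are row vectors indexed by $\{1,2,\ldots\}$; $\mathbf x^{\mathrm t}$ denotes the transpose; $\mathbf 1=(1,1,\ldots)$; $\mathbf 0=(0,0,\ldots)$; $\mathbf e_i$ is the $i$-th unit vector; $\mathbf s^{\mathbf x}=s_1^{x_1}s_2^{x_2}\cdots$. Parameters: $\mathbf H=(h_{ij})_{i,j\ge1}$ is a sub-stochastic matrix (non-negative entries, row sums at most $1$), $\mathbf g=(g_1,g_2,\ldots)$ a probability distribution on $\{1,2,\ldots\}$, $m>0$ a constant. Linear-fractional distribution: for a probability distribution $(h_0,h_1,h_2,\ldots)$ on $\{0,1,2,\ldots\}$ with $\mathbf h=(h_1,h_2,\ldots)$, a random vector $\mathbf Z$ with non-negative integer components and finite sum has distribution $\mathrm{LF}(\mathbf h,\mathbf g,m)$ if $$\mathbb E(\mathbf s^{\mathbf Z})=h_0+\frac{\sum_{i\ge1}h_is_i}{1+m-m\sum_{i\ge1}g_is_i},\qquad\mathbf s\in[0,1]^\infty.$$ Process: in a multi-type Bienaym\'e-Galton-Watson process with types $1,2,\ldots$ each particle lives one unit of time and at death produces offspring independently of all other particles, with law depending only on its type; $\mathbf Z^{(n)}=(Z_1^{(n)},Z_2^{(n)},\ldots)$, where $Z_j^{(n)}$ is the number of type $j$ particles at time $n$. It is linear-fractional with parameters $(\mathbf H,\mathbf g,m)$ if, for each $i$, the offspring vector of a type $i$ particle has distribution $\mathrm{LF}(\mathbf h_i,\mathbf g,m)$, $\mathbf h_i$ being the $i$-th row of $\mathbf H$. Its mean matrix, with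 entries $\mathbb E(Z_j^{(1)}\mid\mathbf Z^{(0)}=\mathbf e_i)$, is $\mathbf M$. Irreducible: for every $(i,j)$ some power $\mathbf M^n$, $n\ge1$, has positive $(i,j)$ entry; aperiodic: the greatest common divisor of all $n\ge1$ such that $(\mathbf M^n)_{ii}>0$ equals $1$. Further quantities: $d_n=\mathbf g\mathbf H^n\mathbf 1^{\mathrm t}$ ($n\ge1$); $f(s)=\sum_{n\ge1}d_ns^n$; $R_f=\inf\{s>0:f(s)=\infty\}$ (with $\inf\emptyset=\infty$, $f(\infty)=\lim_{s\to\infty}f(s)$). If $f(R_f)\ge1/m$, then $\alpha$ is the unique real solution of $mf(e^{-\alpha})=1$ and $\beta=m\sum_{n\ge1}nd_ne^{-\alpha n}$; if $f(R_f)<1/m$, then $\alpha=-\infty$ and $\beta=\infty$. When $\alpha>-\infty$: $R=e^{-\alpha}$ and $\rho=R^{-1}=e^{\alpha}$. Finally $$\mathbf u^{\mathrm t}=(1+m)\beta^{-1}\sum_{k=1}^\infty R^k\mathbf H^k\mathbf 1^{\mathrm t},\qquad\mathbf v=\frac m{1+m}\sum_{k=0}^\infty R^k\mathbf g\mathbf H^k.$$ *)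

theory Defs
  imports "HOL-Probability.Probability"
begin

text \<open>
  The types \<open>1, 2, \<dots>\<close> of the process are represented by \<open>0, 1, \<dots> :: nat\<close>.
  Vectors and matrices are real-valued functions of one or two indices.
  A vector with non-negative integer components and finite sum is a \<open>nat multiset\<close>;
  its \<open>j\<close>-th component is \<open>count z j\<close>, the zero vector is \<open>{#}\<close>,
  and the \<open>i\<close>-th unit vector is \<open>{#i#}\<close>.
\<close>

section \<open>Infinite vectors and matrices\<close>

definition one_vec :: "nat \<Rightarrow> real" where
  "one_vec = (\<lambda>_. 1)"

definition dot :: "(nat \<Rightarrow> real) \<Rightarrow> (nat \<Rightarrow> real) \<Rightarrow> real" where
  "dot x y = (\<Sum>i. x i * y i)"

definition mat_vec :: "(nat \<Rightarrow> nat \<Rightarrow> real) \<Rightarrow> (nat \<Rightarrow> real) \<Rightarrow> nat \<Rightarrow> real" where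
  "mat_vec A y i = (\<Sum>j. A i j * y j)"

definition vec_mat :: "(nat \<Rightarrow> real) \<Rightarrow> (nat \<Rightarrow> nat \<Rightarrow> real) \<Rightarrow> nat \<Rightarrow> real" where
  "vec_mat x A j = (\<Sum>i. x i * A i j)"

definition mat_mult :: "(nat \<Rightarrow> nat \<Rightarrow> real) \<Rightarrow> (nat \<Rightarrow> nat \<Rightarrow> real) \<Rightarrow> nat \<Rightarrow> nat \<Rightarrow> real" where
  "mat_mult A B i j = (\<Sum>k. A i k * B k j)"

primrec mat_pow :: "(nat \<Rightarrow> nat \<Rightarrow> real) \<Rightarrow> nat \<Rightarrow> nat \<Rightarrow> nat \<Rightarrow> real" where
  "mat_pow A 0 = (\<lambda>i j. if i = j then 1 else 0)"
| "mat_pow A (Suc n) = mat_mult A (mat_pow A n)"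

definition irreducible_mat :: "(nat \<Rightarrow> nat \<Rightarrow> real) \<Rightarrow> bool" where
  "irreducible_mat A \<longleftrightarrow> (\<forall>i j. \<exists>n\<ge>1. mat_pow A n i j > 0)"

definition aperiodic_mat :: "(nat \<Rightarrow> nat \<Rightarrow> real) \<Rightarrow> bool" where
  "aperiodic_mat A \<longleftrightarrow> (\<forall>i. Gcd {n. n \<ge> 1 \<and> mat_pow A n i i > 0} = 1)"

definition substochastic :: "(nat \<Rightarrow> nat \<Rightarrow> real) \<Rightarrow> bool" where
  "substochastic A \<longleftrightarrow>
     (\<forall>i j. A i j \<ge> 0) \<and> (\<forall>i. summable (A i) \<and> (\<Sum>j. A i j) \<le> 1)"

definition prob_vec :: "(nat \<Rightarrow> real) \<Rightarrow> bool" where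
  "prob_vec x \<longleftrightarrow> (\<forall>i. x i \<ge> 0) \<and> x sums 1"


section \<open>Multi-type Bienayme-Galton-Watson processes\<close>

text \<open>
  Law of the next generation when the current one is \<open>z\<close>. The particles of \<open>z\<close> are labelled by
  pairs \<open>(i, k)\<close> with \<open>k < count z i\<close>; \<open>Pi_pmf\<close> is the law of a family of independent
  offspring vectors, one for each particle.
\<close>
definition next_gen :: "(nat \<Rightarrow> nat multiset pmf) \<Rightarrow> nat multiset \<Rightarrow> nat multiset pmf" where
  "next_gen off z =
     (let P = (SIGMA i:set_mset z. {..<count z i})
      in map_pmf (\<lambda>\<xi>. \<Sum>p\<in>P. \<xi> p) (Pi_pmf P {#} (\<lambda>(i, k). off i)))"

locale multitype_bgw = prob_space M
  for M :: "'w measure"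
    and off :: "nat \<Rightarrow> nat multiset pmf"
    and Z :: "nat \<Rightarrow> 'w \<Rightarrow> nat multiset" +
  assumes measurable_Z: "Z n \<in> M \<rightarrow>\<^sub>M count_space UNIV"
    and markov: "\<P>(\<omega> in M. \<forall>k\<le>Suc n. Z k \<omega> = z k) =
                 \<P>(\<omega> in M. \<forall>k\<le>n. Z k \<omega> = z k) * pmf (next_gen off (z n)) (z (Suc n))"

text \<open>The matrix with entries \<open>E(Z\<^sub>j\<^sup>(\<^sup>1\<^sup>) | Z\<^sup>(\<^sup>0\<^sup>) = e\<^sub>i)\<close>.\<close>
definition mean_mat :: "(nat \<Rightarrow> nat multiset pmf) \<Rightarrow> nat \<Rightarrow> nat \<Rightarrow> real" where
  "mean_mat off i j = measure_pmf.expectation (next_gen off {#i#}) (\<lambda>z. real (count z j))"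

text \<open>
  The linear-fractional law, where \<open>h\<close> lists the weights \<open>h\<^sub>1, h\<^sub>2, \<dots>\<close> and
  \<open>h\<^sub>0 = 1 - (h\<^sub>1 + h\<^sub>2 + \<dots>)\<close>.
\<close>
definition has_LF :: "nat multiset pmf \<Rightarrow> (nat \<Rightarrow> real) \<Rightarrow> (nat \<Rightarrow> real) \<Rightarrow> real \<Rightarrow> bool" where
  "has_LF p h g m \<longleftrightarrow>
     (\<forall>s. (\<forall>i. 0 \<le> s i \<and> s i \<le> 1) \<longrightarrow>
        measure_pmf.expectation p (\<lambda>z. \<Prod>i\<in>#z. s i) =
          (1 - (\<Sum>i. h i)) + (\<Sum>i. h i * s i) / (1 + m - m * (\<Sum>i. g i * s i)))"


section \<open>Quantities derived from the parameters\<close>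

definition lf_d :: "(nat \<Rightarrow> nat \<Rightarrow> real) \<Rightarrow> (nat \<Rightarrow> real) \<Rightarrow> nat \<Rightarrow> real" where
  "lf_d H g n = dot (vec_mat g (mat_pow H n)) one_vec"

definition lf_f :: "(nat \<Rightarrow> nat \<Rightarrow> real) \<Rightarrow> (nat \<Rightarrow> real) \<Rightarrow> real \<Rightarrow> ennreal" where
  "lf_f H g s = (\<Sum>n. ennreal (lf_d H g (Suc n) * s ^ Suc n))"

definition lf_Rf :: "(nat \<Rightarrow> nat \<Rightarrow> real) \<Rightarrow> (nat \<Rightarrow> real) \<Rightarrow> ennreal" where
  "lf_Rf H g = Inf {ennreal s | s. s > 0 \<and> lf_f H g s = \<infinity>}"

text \<open>The value \<open>f(R\<^sub>f)\<close>, where \<open>R\<^sub>f\<close> may be infinite.\<close>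
definition lf_f_at_Rf :: "(nat \<Rightarrow> nat \<Rightarrow> real) \<Rightarrow> (nat \<Rightarrow> real) \<Rightarrow> ennreal" where
  "lf_f_at_Rf H g =
     (if lf_Rf H g = \<infinity> then Lim at_top (lf_f H g) else lf_f H g (enn2real (lf_Rf H g)))"

definition lf_alpha :: "(nat \<Rightarrow> nat \<Rightarrow> real) \<Rightarrow> (nat \<Rightarrow> real) \<Rightarrow> real \<Rightarrow> ereal" where
  "lf_alpha H g m =
     (if lf_f_at_Rf H g \<ge> ennreal (1 / m)
      then ereal (THE a. ennreal m * lf_f H g (exp (- a)) = 1)
      else - \<infinity>)"

definition lf_beta :: "(nat \<Rightarrow> nat \<Rightarrow> real) \<Rightarrow> (nat \<Rightarrow> real) \<Rightarrow> real \<Rightarrow> ennreal" where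
  "lf_beta H g m =
     (if lf_f_at_Rf H g \<ge> ennreal (1 / m)
      then ennreal m *
        (\<Sum>n. ennreal (real (Suc n) * lf_d H g (Suc n) *
                       exp (- real_of_ereal (lf_alpha H g m) * real (Suc n))))
      else \<infinity>)"

text \<open>
  The following are meaningful only for \<open>lf_alpha H g m > - \<infinity>\<close>, which is implied by
  \<open>lf_beta H g m < \<infinity>\<close>.
\<close>
definition lf_R :: "(nat \<Rightarrow> nat \<Rightarrow> real) \<Rightarrow> (nat \<Rightarrow> real) \<Rightarrow> real \<Rightarrow> real" where
  "lf_R H g m = exp (- real_of_ereal (lf_alpha H g m))"

definition lf_rho :: "(nat \<Rightarrow> nat \<Rightarrow> real) \<Rightarrow> (nat \<Rightarrow> real) \<Rightarrow> real \<Rightarrow> real" where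
  "lf_rho H g m = inverse (lf_R H g m)"

definition lf_u :: "(nat \<Rightarrow> nat \<Rightarrow> real) \<Rightarrow> (nat \<Rightarrow> real) \<Rightarrow> real \<Rightarrow> nat \<Rightarrow> real" where
  "lf_u H g m i =
     (1 + m) / enn2real (lf_beta H g m) *
       (\<Sum>k. lf_R H g m ^ Suc k * mat_vec (mat_pow H (Suc k)) one_vec i)"

definition lf_v :: "(nat \<Rightarrow> nat \<Rightarrow> real) \<Rightarrow> (nat \<Rightarrow> real) \<Rightarrow> real \<Rightarrow> nat \<Rightarrow> real" where
  "lf_v H g m j = m / (1 + m) * (\<Sum>k. lf_R H g m ^ k * vec_mat g (mat_pow H k) j)"


section \<open>The mean matrix of a linear-fractional process\<close>

lemma next_gen_single: "next_gen off {#i#} = off i"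
proof -
  have P: "(SIGMA j:set_mset {#i#}. {..<count {#i#} j}) = {(i, 0)}" by auto
  show ?thesis
    unfolding next_gen_def P Let_def
    by (simp add: Pi_pmf_singleton map_pmf_comp)
qed

lemma mean_mat_linear_fractional:
  assumes H: "substochastic H" and g: "prob_vec g" and m: "m > 0"
    and LF: "has_LF (off i) (H i) g m"
  shows "integrable (measure_pmf (next_gen off {#i#})) (\<lambda>z. real (count z j))"
    and "mean_mat off i j = H i j + m * mat_vec H one_vec i * g j"
proof -
  define t :: "nat \<Rightarrow> real" where "t n = 1 - 1 / real (Suc n)" for n
  have t: "0 \<le> t n" "t n < 1" "1 - t n > 0" for n by (auto simp: t_def)
  have t_mono: "t a \<le> t b" if "a \<le> b" for a b
    using that by (auto simp: t_def frac_le)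
  have t_lim: "t \<longlonglongrightarrow> 1"
    unfolding t_def using tendsto_diff[OF tendsto_const LIMSEQ_inverse_real_of_nat, of 1]
    by (simp add: divide_inverse)
  define A where "A = (\<Sum>k. H i k)"
  have H_sums: "H i sums A" using H by (auto simp: substochastic_def A_def)
  have g_sums: "g sums 1" and g0: "g j \<ge> 0" using g by (auto simp: prob_vec_def)
  define s where "s n k = (if k = j then t n else 1)" for n k
  have *: "(\<lambda>k. x k * s n k) sums (B - x j * (1 - t n))" if "x sums B" for x B n
  proof -
    have "(\<lambda>k. if k = j then x j * (1 - t n) else 0) sums (x j * (1 - t n))"
      by (rule sums_single[of j "\<lambda>_. x j * (1 - t n)"])
    from sums_diff[OF that this] show ?thesis
      by (rule back_subst[of "\<lambda>f. f sums _"]) (auto simp: s_def algebra_simps)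
  qed
  have prod_s: "(\<Prod>k\<in>#z. s n k) = t n ^ count z j" for n z
    by (induction z) (auto simp: s_def)
  have den: "1 + m * g j * (1 - t n) > 0" for n
  proof -
    have "m * g j * (1 - t n) \<ge> 0"
      using m g0 t[of n] by (intro mult_nonneg_nonneg) auto
    thus ?thesis by linarith
  qed
  have E: "measure_pmf.expectation (off i) (\<lambda>z. t n ^ count z j) =
      1 - A + (A - H i j * (1 - t n)) / (1 + m * g j * (1 - t n))" for n
  proof -
    have "\<forall>k. 0 \<le> s n k \<and> s n k \<le> 1" using t[of n] by (auto simp: s_def)
    with LF have "measure_pmf.expectation (off i) (\<lambda>z. \<Prod>k\<in>#z. s n k) =
      1 - (\<Sum>k. H i k) + (\<Sum>k. H i k * s n k) / (1 + m - m * (\<Sum>k. g k * s n k))"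
      unfolding has_LF_def by blast
    moreover have "(\<Sum>k. H i k * s n k) = A - H i j * (1 - t n)"
      using *[OF H_sums, of n] by (rule sums_unique[symmetric])
    moreover have "(\<Sum>k. g k * s n k) = 1 - g j * (1 - t n)"
      using *[OF g_sums, of n] by (rule sums_unique[symmetric])
    moreover have "1 + m - m * (1 - g j * (1 - t n)) = 1 + m * g j * (1 - t n)"
      by (simp add: algebra_simps)
    ultimately show ?thesis by (simp add: prod_s A_def)
  qed
  define G where "G n z = (\<Sum>k<count z j. t n ^ k)" for n z
  have G_eq: "G n z = (1 - t n ^ count z j) / (1 - t n)" for n z
    using t[of n] by (simp add: G_def sum_gp_strict)
  have int_pow: "integrable (measure_pmf (off i)) (\<lambda>z. t n ^ count z j)" for n
    by (rule measure_pmf.integrable_const_bound[of _ 1])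
       (use t[of n] in \<open>auto simp: power_le_one less_imp_le\<close>)
  have int_G: "integrable (measure_pmf (off i)) (G n)" for n
    unfolding G_eq using int_pow[of n] by auto
  have EG: "measure_pmf.expectation (off i) (G n) =
      (H i j + A * m * g j) / (1 + m * g j * (1 - t n))" for n
  proof -
    have "measure_pmf.expectation (off i) (G n) =
        (1 - measure_pmf.expectation (off i) (\<lambda>z. t n ^ count z j)) / (1 - t n)"
      unfolding G_eq using int_pow[of n] by simp
    also have "\<dots> = (H i j + A * m * g j) / (1 + m * g j * (1 - t n))"
    proof -
      have "1 - t n \<noteq> 0" "1 + m * g j * (1 - t n) \<noteq> 0" using t[of n] den[of n] by auto
      thus ?thesis unfolding E
        by (simp add: divide_simps) (simp add: algebra_simps)
    qed
    finally show ?thesis .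
  qed
  have lim: "(\<lambda>n. measure_pmf.expectation (off i) (G n)) \<longlonglongrightarrow> H i j + A * m * g j"
  proof -
    have "(\<lambda>n. (H i j + A * m * g j) / (1 + m * g j * (1 - t n))) \<longlonglongrightarrow>
        (H i j + A * m * g j) / (1 + m * g j * (1 - 1))"
      by (intro tendsto_intros t_lim) auto
    thus ?thesis by (simp add: EG)
  qed
  have G_mono: "mono (\<lambda>n. G n z)" for z
    unfolding G_def by (intro monoI sum_mono power_mono t_mono t)
  have G_lim: "(\<lambda>n. G n z) \<longlonglongrightarrow> real (count z j)" for z
  proof -
    have "(\<lambda>n. G n z) \<longlonglongrightarrow> (\<Sum>k<count z j. 1 ^ k)"
      unfolding G_def by (intro tendsto_intros t_lim)
    thus ?thesis by simp
  qed
  show "integrable (measure_pmf (next_gen off {#i#})) (\<lambda>z. real (count z j))"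
    unfolding next_gen_single
    by (rule integrable_monotone_convergence[OF int_G _ _ lim])
       (use G_mono G_lim in auto)
  have "measure_pmf.expectation (off i) (\<lambda>z. real (count z j)) = H i j + A * m * g j"
    by (rule integral_monotone_convergence[OF int_G _ _ lim])
       (use G_mono G_lim in auto)
  thus "mean_mat off i j = H i j + m * mat_vec H one_vec i * g j"
    by (simp add: mean_mat_def next_gen_single mat_vec_def one_vec_def A_def mult_ac)
qed

end

theory Submission
  imports Defs "HOL-Complex_Analysis.Complex_Analysis" "HOL-Real_Asymp.Real_Asymp"
begin

text \<open>
  In the coordinates \<open>x = 1 - s\<close> the one-step generating functions form the projective map
  \<open>x \<mapsto> M x / (1 + m g x)\<close> with \<open>M x = H x + m (g x) H 1\<close>, so the \<open>n\<close>-step ones are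
  \<open>1 - M\<^sup>n x / (1 + m (a\<^sub>0 + \<dots> + a\<^bsub>n-1\<^esub>))\<close> with \<open>a\<^sub>k = g M\<^sup>k x\<close>. The sequence \<open>a\<close> solves a renewal
  equation with weights \<open>m d\<^sub>k\<close>. Since \<open>d\<^sub>k \<le> 1\<close> and \<open>R = 1 / \<rho> < 1\<close>, the normalised weights
  \<open>m d\<^sub>k R\<^sup>k\<close> form a probability distribution with a geometric tail, and \<open>d\<^sub>1 > 0\<close> because \<open>d\<close> is
  decreasing; hence \<open>R\<^sup>n a\<^sub>n\<close> and \<open>R\<^sup>n M\<^sup>n x\<close> converge. Taking \<open>s = 0\<close> gives the survival probability.
  Taking \<open>s\<close> constant shows that the total population is exactly zero-modified geometric, hence
  asymptotically exponential given survival. A functional \<open>Z w\<close> is asymptotically a multiple of the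
  total population: for \<open>w \<ge> 0\<close> the expected squared difference of the exponentials of the two
  normalised quantities tends to \<open>0\<close>, and a bounded \<open>w\<close> is shifted by a multiple of \<open>1\<close>.
\<close>

section \<open>A renewal theorem for geometric tails\<close>

text \<open>With infinitely many types there is no finite-dimensional Perron-Frobenius theory to
  quote. Its substitute is that \<open>M\<close> is a rank-one perturbation of \<open>H\<close>, so
  that \<open>M^n x\<close> is governed by the scalars \<open>g M^k x\<close>. The factor rho - 1 =
  (1 - R) / R in both limits comes from the denominators, where terms growing like R^(-k) add up to
  R / (1 - R) times the n-th one. For non-constant \<open>w\<close> the law of \<open>Z w\<close> is
  not explicit, and only the limit of its Laplace transform at arguments of order R^n is computed.
  Comparing \<open>Z w\<close> with the total population, whose law is explicit, takes the place of
  inverting transforms. Limits are taken for unconditioned laws, so the limiting tails carry the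
  survival probability as a factor; conditioning is a single division at the end.\<close>

lemma conv_radius_ge_geometric:
  fixes a :: "nat \<Rightarrow> 'a :: {banach, real_normed_div_algebra}"
  assumes "0 < r" and bound: "\<And>n. norm (a n) \<le> K * r ^ n"
  shows "conv_radius a \<ge> ereal (1 / r)"
proof (rule conv_radius_geI_ex)
  fix s :: real assume s: "0 < s" "ereal s < ereal (1 / r)"
  have "norm (a n * of_real s ^ n) \<le> K * (r * s) ^ n" for n
    using mult_right_mono[OF bound[of n], of "s ^ n"] s
    by (simp add: norm_mult norm_power power_mult_distrib mult_ac)
  moreover have "summable (\<lambda>n. K * (r * s) ^ n)"
    using s \<open>0 < r\<close> by (intro summable_mult summable_geometric) (auto simp: field_simps)
  ultimately have "summable (\<lambda>n. a n * of_real s ^ n)"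
    by (rule summable_comparison_test'[where N = 0, rotated])
  thus "\<exists>z. norm z = s \<and> summable (\<lambda>n. a n * z ^ n)"
    using s(1) by (intro exI[of _ "of_real s"]) simp
qed

lemma fps_gp_mult: "(1 - fps_X) * Abs_fps (\<lambda>_. 1) = (1 :: 'a :: comm_ring_1 fps)"
  by (rule fps_ext) (simp add: left_diff_distrib)

text \<open>The zeros in a slightly larger closed disc form a compact set. Either it is empty, or it
  has an element of least modulus, which exceeds 1 and serves as the radius. This is what makes
  \<open>inverse F\<close> converge beyond the unit disc.\<close>

lemma fps_nonzero_beyond_unit_disc:
  fixes F :: "complex fps"
  assumes radius: "fps_conv_radius F > 1"
    and nz: "\<And>z. norm z \<le> 1 \<Longrightarrow> eval_fps F z \<noteq> 0"
  obtains r where "r > 1" "\<And>z. norm z < r \<Longrightarrow> eval_fps F z \<noteq> 0"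
proof -
  obtain s where s: "1 < s" "ereal s < fps_conv_radius F"
  proof -
    obtain t where "ereal 1 < t" "t < fps_conv_radius F"
      using dense[OF radius] by (auto simp: one_ereal_def)
    thus ?thesis using that by (cases t) auto
  qed
  have cont: "continuous_on (cball 0 s) (eval_fps F)"
    by (rule continuous_on_subset[OF continuous_on_eval_fps])
       (use le_less_trans[of _ "ereal s", OF _ s(2)] in \<open>auto simp: in_eball_iff\<close>)
  define N where "N = {z \<in> cball 0 s. eval_fps F z = 0}"
  have "compact N"
    unfolding N_def
    using continuous_closed_preimage_constant[OF cont closed_cball, of 0]
    by (intro compact_eq_bounded_closed[THEN iffD2] conjI)
       (auto intro: bounded_subset[OF bounded_cball[of 0 s]])
  show ?thesis
  proof (cases "N = {}")
    case True
    thus ?thesis using s that[of s] by (auto simp: N_def)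
  next
    case False
    obtain z0 where z0: "z0 \<in> N" "\<And>z. z \<in> N \<Longrightarrow> norm z0 \<le> norm z"
      using continuous_attains_inf[OF \<open>compact N\<close> False, of norm]
      by (auto intro: continuous_intros)
    have "norm z0 > 1" using z0(1) nz[of z0] by (simp add: N_def) (meson not_le)
    moreover have "norm z0 \<le> s" using z0(1) by (auto simp: N_def)
    moreover have "eval_fps F z \<noteq> 0" if "norm z < norm z0" for z
      using z0(2)[of z] that calculation by (auto simp: N_def)
    ultimately show ?thesis using that by blast
  qed
qed

text \<open>
  The generating function of \<open>a\<close> is \<open>C / (1 - P) = (C / Q) / (1 - X)\<close>, so \<open>a\<close> is the sequence
  of partial sums of the coefficients of \<open>C / Q\<close>; these are summable because \<open>Q\<close> has no zeros
  in the closed unit disc, and \<open>Q(1) = P'(1)\<close>.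
\<close>
theorem renewal_theorem_geometric:
  fixes p c a :: "nat \<Rightarrow> real"
  assumes p0: "p 0 = 0" and p_nonneg: "\<And>n. p n \<ge> 0" and p1: "p 1 > 0" and p_sums: "p sums 1"
    and r: "0 < r" "r < 1"
    and p_le: "\<And>n. p n \<le> K * r ^ n" and c_le: "\<And>n. \<bar>c n\<bar> \<le> L * r ^ n"
    and renewal: "\<And>n. a n = c n + (\<Sum>k\<le>n. p k * a (n - k))"
  shows "a \<longlonglongrightarrow> (\<Sum>n. c n) / (\<Sum>n. real (Suc n) * p (Suc n))"
proof -
  define P where "P = Abs_fps (\<lambda>n. complex_of_real (p n))"
  define C where "C = Abs_fps (\<lambda>n. complex_of_real (c n))"
  define A where "A = Abs_fps (\<lambda>n. complex_of_real (a n))"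
  define G where "G = Abs_fps (\<lambda>_. 1 :: complex)"
  define Q where "Q = (1 - P) * G"
  have big: "1 < ereal (1 / r)" using r by (simp add: one_ereal_def)
  have P_radius: "fps_conv_radius P \<ge> ereal (1 / r)"
    unfolding fps_conv_radius_def P_def
    using p_le p_nonneg r(1) by (intro conv_radius_ge_geometric) auto
  have C_radius: "fps_conv_radius C \<ge> ereal (1 / r)"
    unfolding fps_conv_radius_def C_def
    using c_le r(1) by (intro conv_radius_ge_geometric) auto
  \<comment> \<open>Partial sums of the coefficients of \<open>1 - P\<close> are tails of
    \<open>p\<close> because \<open>p\<close> has total mass 1. Tails of a geometrically bounded
    sequence are again geometrically bounded, so \<open>Q\<close> keeps the radius of
    \<open>P\<close>.\<close>
  have Q_nth: "fps_nth Q n = of_real (\<Sum>k. p (k + Suc n))" for n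
  proof -
    have "fps_nth Q n = (\<Sum>k\<le>n. fps_nth (1 - P) k)"
      by (simp add: Q_def G_def fps_mult_nth atLeast0AtMost)
    also have "\<dots> = (\<Sum>k\<le>n. (if k = 0 then 1 else 0)) - (\<Sum>k\<le>n. of_real (p k))"
      by (simp add: P_def sum_subtractf)
    also have "(\<Sum>k\<le>n. (if k = 0 then 1 else 0)) = (1 :: complex)" by simp
    also have "1 - (\<Sum>k\<le>n. complex_of_real (p k)) = of_real (1 - (\<Sum>k\<le>n. p k))" by simp
    also have "1 - (\<Sum>k\<le>n. p k) = (\<Sum>k. p (k + Suc n))"
      using suminf_split_initial_segment[of p "Suc n"] p_sums
      by (simp add: sums_iff lessThan_Suc_atMost)
    finally show ?thesis .
  qed
  have Q_radius: "fps_conv_radius Q \<ge> ereal (1 / r)"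
    unfolding fps_conv_radius_def
  proof (rule conv_radius_ge_geometric[OF r(1)])
    fix n
    have geo: "(\<lambda>k. K * r ^ Suc n * r ^ k) sums (K * r ^ Suc n * (1 / (1 - r)))"
      using r by (intro sums_mult geometric_sums) auto
    have "(\<Sum>k. p (k + Suc n)) \<le> K * r ^ Suc n * (1 / (1 - r))"
      using geo p_le[of "_ + Suc n"] p_sums
      by (subst sums_unique[OF geo], intro suminf_le)
         (auto simp: sums_iff power_add mult_ac summable_iff_shift simp del: add_Suc_right power_Suc)
    moreover have "(\<Sum>k. p (k + Suc n)) \<ge> 0"
      using p_sums p_nonneg
      by (intro suminf_nonneg) (auto simp: sums_iff summable_iff_shift simp del: add_Suc_right)
    ultimately show "norm (fps_nth Q n) \<le> (K * r / (1 - r)) * r ^ n"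
      by (simp add: Q_nth mult_ac)
  qed
  have XQ: "(1 - fps_X) * Q = 1 - P"
    using fps_gp_mult[where 'a = complex] by (simp add: Q_def G_def mult_ac)
  have eval_XQ: "(1 - z) * eval_fps Q z = 1 - eval_fps P z" if "norm z \<le> 1" for z
  proof -
    have *: "ereal (norm z) < ereal (1 / r)" using that big
      by (metis ereal_less_eq(3) le_less_trans one_ereal_def)
    have 1: "norm z < fps_conv_radius P" "norm z < fps_conv_radius Q"
      using less_le_trans[OF * P_radius] less_le_trans[OF * Q_radius] by simp_all
    have rX: "fps_conv_radius (1 - fps_X :: complex fps) = \<infinity>"
      using fps_conv_radius_diff[of "1 :: complex fps" fps_X] by simp
    show ?thesis
      using arg_cong[OF XQ, of "\<lambda>F. eval_fps F z"] 1 rX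
      by (simp add: eval_fps_mult eval_fps_diff)
  qed
  have mean: "eval_fps Q 1 = of_real (\<Sum>n. real (Suc n) * p (Suc n))"
  proof -
    have 2: "norm (1::complex) < fps_conv_radius (fps_deriv P)"
      "norm (1::complex) < fps_conv_radius (fps_deriv Q)"
      using less_le_trans[OF less_le_trans[OF big P_radius] fps_conv_radius_deriv]
        less_le_trans[OF less_le_trans[OF big Q_radius] fps_conv_radius_deriv]
      by (simp_all add: one_ereal_def)
    have rX: "fps_conv_radius (1 - fps_X :: complex fps) = \<infinity>"
      using fps_conv_radius_diff[of "1 :: complex fps" fps_X] by simp
    \<comment> \<open>At 1 the quotient (1 - P) / (1 - X) has the form 0/0. Differentiating the
      product identity instead leaves \<open>Q\<close> plus a multiple of \<open>1 - fps_X\<close>,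
      which vanishes there.\<close>
    have "(1 - fps_X) * fps_deriv Q - Q = - fps_deriv P"
      using arg_cong[OF XQ, of fps_deriv] by (simp add: algebra_simps)
    hence "Q = fps_deriv P + (1 - fps_X) * fps_deriv Q" by (simp add: algebra_simps)
    hence "eval_fps Q 1 = eval_fps (fps_deriv P + (1 - fps_X) * fps_deriv Q) 1" by simp
    also have "\<dots> = eval_fps (fps_deriv P) 1 + eval_fps ((1 - fps_X) * fps_deriv Q) 1"
      using 2 rX fps_conv_radius_mult[of "1 - fps_X" "fps_deriv Q"]
      by (intro eval_fps_add) (auto intro: less_le_trans)
    also have "eval_fps ((1 - fps_X) * fps_deriv Q) 1 = 0"
      using 2 rX by (subst eval_fps_mult) (auto simp: eval_fps_diff)
    finally have "eval_fps Q 1 = eval_fps (fps_deriv P) 1" by simp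
    moreover have "(\<lambda>n. complex_of_real (real (Suc n) * p (Suc n))) sums eval_fps (fps_deriv P) 1"
      using sums_eval_fps[OF 2(1)] by (simp add: P_def)
    hence "summable (\<lambda>n. real (Suc n) * p (Suc n))" and
      "eval_fps (fps_deriv P) 1 = of_real (\<Sum>n. real (Suc n) * p (Suc n))"
      by (auto simp: sums_iff summable_complex_of_real suminf_of_real simp del: of_real_mult of_nat_Suc)
    ultimately show ?thesis by simp
  qed
  have mean_pos: "(\<Sum>n. real (Suc n) * p (Suc n)) > 0"
  proof -
    have 1: "norm (1::complex) < fps_conv_radius (fps_deriv P)"
      using less_le_trans[OF less_le_trans[OF big P_radius] fps_conv_radius_deriv]
      by (simp add: one_ereal_def)
    have "summable (\<lambda>n. complex_of_real (real (Suc n) * p (Suc n)))"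
      using sums_eval_fps[OF 1] by (simp add: P_def sums_iff)
    hence "summable (\<lambda>n. real (Suc n) * p (Suc n))"
      by (simp only: summable_complex_of_real)
    thus ?thesis
      using p1 p_nonneg by (intro suminf_pos2[of _ 0]) auto
  qed
  \<comment> \<open>A zero of \<open>Q\<close> gives P(z) = 1. Taking real parts, the nonnegative
    terms \<open>p n * (1 - Re (z ^ n))\<close> sum to 0, and since \<open>p 1 > 0\<close> the term
    n = 1 forces Re z = 1, hence z = 1. There \<open>Q\<close> equals the positive mean. Thus
    \<open>p 1 > 0\<close> rules out periodicity.\<close>
  have Q_nz: "eval_fps Q z \<noteq> 0" if z: "norm z \<le> 1" for z
  proof
    assume "eval_fps Q z = 0"
    with eval_XQ[OF z] have "eval_fps P z = 1" by simp
    moreover have "norm z < fps_conv_radius P"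
      using z big P_radius by (metis ereal_less_eq(3) le_less_trans less_le_trans one_ereal_def)
    ultimately have "(\<lambda>n. complex_of_real (p n) * z ^ n) sums 1"
      using sums_eval_fps[of z P] by (simp add: P_def)
    from sums_Re[OF this] have "(\<lambda>n. p n * Re (z ^ n)) sums 1" by simp
    from sums_diff[OF p_sums this] have *: "(\<lambda>n. p n * (1 - Re (z ^ n))) sums 0"
      by (simp add: algebra_simps)
    have nn: "p n * (1 - Re (z ^ n)) \<ge> 0" for n
    proof -
      have "Re (z ^ n) \<le> norm (z ^ n)" by (rule complex_Re_le_cmod)
      also have "\<dots> \<le> 1" using z by (simp add: norm_power power_le_one)
      finally show ?thesis using p_nonneg[of n] by simp
    qed
    have "p 1 * (1 - Re (z ^ 1)) = 0"
      using * nn suminf_eq_zero_iff[of "\<lambda>n. p n * (1 - Re (z ^ n))"] by (auto simp: sums_iff)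
    hence Re: "Re z = 1" using p1 by auto
    hence "Im z = 0"
      using z cmod_power2[of z] power_mono[OF z, of 2] by auto
    with Re have "z = 1" by (simp add: complex_eq_iff)
    with \<open>eval_fps Q z = 0\<close> mean mean_pos show False by simp
  qed
  obtain s where s: "s > 1" "\<And>z. norm z < s \<Longrightarrow> eval_fps Q z \<noteq> 0"
    using fps_nonzero_beyond_unit_disc[of Q] Q_radius big Q_nz by (metis less_le_trans)
  define D where "D = C * inverse Q"
  have inv_radius: "fps_conv_radius (inverse Q) > 1"
  proof -
    have "min (ereal s) (fps_conv_radius Q) \<le> fps_conv_radius (inverse Q)"
      using s(2) by (intro fps_conv_radius_inverse) auto
    moreover have "1 < min (ereal s) (fps_conv_radius Q)"
      using s(1) less_le_trans[OF big Q_radius] by (simp add: one_ereal_def)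
    ultimately show ?thesis by (rule less_le_trans[rotated])
  qed
  have rC: "1 < fps_conv_radius C" and rQ: "1 < fps_conv_radius Q"
    using less_le_trans[OF big C_radius] less_le_trans[OF big Q_radius] .
  have rD: "1 < fps_conv_radius D"
  proof -
    have "1 < min (fps_conv_radius C) (fps_conv_radius (inverse Q))"
      using rC inv_radius by simp
    thus ?thesis unfolding D_def by (rule less_le_trans) (rule fps_conv_radius_mult)
  qed
  have "eval_fps D 1 = eval_fps C 1 / eval_fps Q 1"
  proof -
    have "eval_fps (inverse Q) 1 = inverse (eval_fps Q 1)"
      using s rQ by (intro eval_fps_inverse[where r = s]) (auto simp: one_ereal_def)
    thus ?thesis unfolding D_def
      using rC inv_radius by (subst eval_fps_mult) (auto simp: divide_inverse one_ereal_def)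
  qed
  also have "eval_fps C 1 = of_real (\<Sum>n. c n)"
  proof -
    have "summable c"
      by (rule summable_comparison_test'[where N = 0 and g = "\<lambda>n. L * r ^ n"])
         (use c_le r in \<open>auto intro!: summable_mult summable_geometric\<close>)
    thus ?thesis by (simp add: eval_fps_def C_def suminf_of_real)
  qed
  finally have D1: "eval_fps D 1 = of_real ((\<Sum>n. c n) / (\<Sum>n. real (Suc n) * p (Suc n)))"
    by (simp add: mean)
  have "A = C + P * A"
  proof (rule fps_ext)
    fix n
    show "fps_nth A n = fps_nth (C + P * A) n"
      using renewal[of n] by (simp add: A_def C_def P_def fps_mult_nth atLeast0AtMost)
  qed
  hence "A * (1 - P) = C" by (simp add: algebra_simps)
  hence "A * (1 - fps_X) * (Q * inverse Q) = D"
    unfolding D_def XQ[symmetric] by (simp add: mult_ac)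
  moreover have "Q * inverse Q = 1"
  proof -
    have "fps_nth Q 0 = 1" by (simp add: Q_def P_def G_def p0)
    thus ?thesis by (metis inverse_mult_eq_1 mult.commute zero_neq_one)
  qed
  ultimately have "D * G = A * ((1 - fps_X) * G)" by (simp add: mult_ac)
  hence "A = D * G" using fps_gp_mult[where 'a = complex] by (simp add: G_def)
  hence A_nth: "complex_of_real (a n) = (\<Sum>k\<le>n. fps_nth D k)" for n
    by (simp add: fps_eq_iff A_def G_def fps_mult_nth atLeast0AtMost)
  have "(\<lambda>n. fps_nth D n) sums eval_fps D 1"
    using sums_eval_fps[of 1 D] rD by (simp add: one_ereal_def)
  hence "(\<lambda>n. complex_of_real (a n)) \<longlonglongrightarrow> eval_fps D 1"
    by (simp add: A_nth sums_def_le)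
  thus ?thesis by (simp only: D1 tendsto_of_real_iff)
qed

section \<open>Generations of a branching process\<close>

lemma prod_mset_sum:
  fixes t :: "'a \<Rightarrow> 'b :: comm_monoid_mult"
  shows "(\<Prod>j\<in>#(\<Sum>p\<in>P. \<xi> p). t j) = (\<Prod>p\<in>P. \<Prod>j\<in>#\<xi> p. t j)"
  by (induction P rule: infinite_finite_induct) auto

lemma prod_mset_unit_interval:
  fixes t :: "'a \<Rightarrow> real"
  assumes "\<And>i. 0 \<le> t i" "\<And>i. t i \<le> 1"
  shows "0 \<le> (\<Prod>j\<in>#z. t j)" "(\<Prod>j\<in>#z. t j) \<le> 1"
proof -
  have "0 \<le> (\<Prod>j\<in>#z. t j) \<and> (\<Prod>j\<in>#z. t j) \<le> 1"
    by (induction z) (use assms in \<open>auto intro: mult_le_one\<close>)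
  thus "0 \<le> (\<Prod>j\<in>#z. t j)" "(\<Prod>j\<in>#z. t j) \<le> 1" by auto
qed

lemma integrable_prod_mset_pmf:
  fixes t :: "'a \<Rightarrow> real"
  assumes "\<And>i. 0 \<le> t i" "\<And>i. t i \<le> 1"
  shows "integrable (measure_pmf p) (\<lambda>z. \<Prod>j\<in>#z. t j)"
  by (rule measure_pmf.integrable_const_bound[of _ 1])
     (use prod_mset_unit_interval[of t] assms in \<open>auto intro!: AE_I2\<close>)

text \<open>Passing through the nonnegative integral makes the iterated integral available; values
  in [0,1] settle all integrability conditions.\<close>

lemma expectation_bind_pmf_unit_interval:
  fixes f :: "'b \<Rightarrow> real"
  assumes f: "\<And>y. 0 \<le> f y" "\<And>y. f y \<le> 1"
  shows "measure_pmf.expectation (bind_pmf p q) f =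
    measure_pmf.expectation p (\<lambda>x. measure_pmf.expectation (q x) f)"
proof -
  have int: "integrable (measure_pmf r) f" for r
    by (rule measure_pmf.integrable_const_bound[of _ 1]) (use f in auto)
  have E: "0 \<le> measure_pmf.expectation r f" "measure_pmf.expectation r f \<le> 1" for r
    using f int by (auto intro!: integral_nonneg_AE measure_pmf.integral_le_const)
  have nn: "(\<integral>\<^sup>+y. ennreal (f y) \<partial>measure_pmf r) = ennreal (measure_pmf.expectation r f)" for r
    using int f by (intro nn_integral_eq_integral) auto
  have "integrable (measure_pmf p) (\<lambda>x. measure_pmf.expectation (q x) f)"
    by (rule measure_pmf.integrable_const_bound[of _ 1]) (use E in auto)
  hence "(\<integral>\<^sup>+x. ennreal (measure_pmf.expectation (q x) f) \<partial>measure_pmf p) =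
      ennreal (measure_pmf.expectation p (\<lambda>x. measure_pmf.expectation (q x) f))"
    using E by (intro nn_integral_eq_integral) auto
  hence "ennreal (measure_pmf.expectation (bind_pmf p q) f) =
      ennreal (measure_pmf.expectation p (\<lambda>x. measure_pmf.expectation (q x) f))"
    by (simp add: nn[symmetric] del: measure_pmf_bind)
  thus ?thesis using E by (subst (asm) ennreal_inj) (auto intro!: integral_nonneg_AE)
qed

definition offspring_pgf :: "(nat \<Rightarrow> nat multiset pmf) \<Rightarrow> (nat \<Rightarrow> real) \<Rightarrow> nat \<Rightarrow> real" where
  "offspring_pgf off t i = measure_pmf.expectation (off i) (\<lambda>z. \<Prod>j\<in>#z. t j)"

lemma offspring_pgf_unit_interval:
  assumes "\<And>i. 0 \<le> t i" "\<And>i. t i \<le> 1"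
  shows "0 \<le> offspring_pgf off t i" "offspring_pgf off t i \<le> 1"
proof -
  show "0 \<le> offspring_pgf off t i"
    unfolding offspring_pgf_def
    by (rule integral_nonneg_AE) (use prod_mset_unit_interval[of t] assms in auto)
  show "offspring_pgf off t i \<le> 1"
    unfolding offspring_pgf_def
    by (rule measure_pmf.integral_le_const)
       (use prod_mset_unit_interval[of t] integrable_prod_mset_pmf[of t] assms in auto)
qed

text \<open>Independence of the offspring turns the expected product over all labelled particles
  into a product of expectations. Grouping the labels \<open>(i, k)\<close> by type gives one factor
  per particle of \<open>z\<close>.\<close>

lemma expectation_next_gen:
  assumes t: "\<And>i. 0 \<le> t i" "\<And>i. t i \<le> 1"
  shows "measure_pmf.expectation (next_gen off z) (\<lambda>c. \<Prod>j\<in>#c. t j) =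
    (\<Prod>i\<in>#z. offspring_pgf off t i)"
proof -
  define P where "P = (SIGMA i:set_mset z. {..<count z i})"
  have [simp]: "finite P" by (auto simp: P_def)
  have "measure_pmf.expectation (next_gen off z) (\<lambda>c. \<Prod>j\<in>#c. t j) =
      measure_pmf.expectation (Pi_pmf P {#} (\<lambda>q. off (fst q))) (\<lambda>\<xi>. \<Prod>q\<in>P. \<Prod>j\<in>#\<xi> q. t j)"
    by (simp add: next_gen_def P_def[symmetric] Let_def prod_mset_sum case_prod_unfold)
  also have "\<dots> = (\<Prod>q\<in>P. offspring_pgf off t (fst q))"
    unfolding offspring_pgf_def
    by (rule expectation_prod_Pi_pmf)
       (use t integrable_prod_mset_pmf[of t] prod_mset_unit_interval[of t] in auto)
  also have "\<dots> = (\<Prod>i\<in>set_mset z. \<Prod>k<count z i. offspring_pgf off t i)"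
    unfolding P_def by (subst prod.Sigma) (auto simp: case_prod_unfold)
  also have "\<dots> = (\<Prod>i\<in>#z. offspring_pgf off t i)"
    by (simp add: image_prod_mset_multiplicity)
  finally show ?thesis .
qed

text \<open>The recursion splits off the first generation, not the last. The generating function is
  therefore composed on the outside, matching \<open>funpow\<close>, and a known path can be
  extended by one generation at a time.\<close>

primrec generation :: "(nat \<Rightarrow> nat multiset pmf) \<Rightarrow> nat \<Rightarrow> nat multiset \<Rightarrow> nat multiset pmf" where
  "generation off 0 z = return_pmf z"
| "generation off (Suc n) z = bind_pmf (next_gen off z) (generation off n)"

lemma offspring_pgf_iterate_unit_interval:
  assumes "\<And>i. 0 \<le> t i" "\<And>i. t i \<le> 1"
  shows "0 \<le> (offspring_pgf off ^^ n) t i \<and> (offspring_pgf off ^^ n) t i \<le> 1"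
proof (induction n arbitrary: i)
  case (Suc n)
  thus ?case using offspring_pgf_unit_interval[of "(offspring_pgf off ^^ n) t"] by simp
qed (use assms in auto)

lemma expectation_generation:
  assumes t: "\<And>i. 0 \<le> t i" "\<And>i. t i \<le> 1"
  shows "measure_pmf.expectation (generation off n z) (\<lambda>c. \<Prod>j\<in>#c. t j) =
    (\<Prod>i\<in>#z. (offspring_pgf off ^^ n) t i)"
proof (induction n arbitrary: z)
  case (Suc n)
  have "measure_pmf.expectation (generation off (Suc n) z) (\<lambda>c. \<Prod>j\<in>#c. t j) =
      measure_pmf.expectation (next_gen off z)
        (\<lambda>y. measure_pmf.expectation (generation off n y) (\<lambda>c. \<Prod>j\<in>#c. t j))"
    using prod_mset_unit_interval[of t] t by (simp add: expectation_bind_pmf_unit_interval)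
  also have "\<dots> = (\<Prod>i\<in>#z. offspring_pgf off ((offspring_pgf off ^^ n) t) i)"
    unfolding Suc.IH using offspring_pgf_iterate_unit_interval[of t] t
    by (intro expectation_next_gen) auto
  finally show ?case by simp
qed simp

lemma countable_UNIV_multiset: "countable (UNIV :: 'a :: countable multiset set)"
  using countable_image[of "UNIV :: 'a list set" mset] by (simp add: surj_mset)

context multitype_bgw
begin

lemma cylinder_in_events: "{\<omega> \<in> space M. (\<forall>k\<le>l. Z k \<omega> = y k) \<and> Z n \<omega> \<in> B} \<in> events"
proof -
  have ev: "{\<omega> \<in> space M. Z k \<omega> \<in> S} \<in> events" for k S
    using measurable_sets[OF measurable_Z, of S k] by (simp add: vimage_def Int_def conj_commute)
  have "{\<omega> \<in> space M. (\<forall>k\<le>l. Z k \<omega> = y k) \<and> Z n \<omega> \<in> B} =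
      {\<omega> \<in> space M. Z n \<omega> \<in> B} \<inter> (\<Inter>k\<in>{..l}. {\<omega> \<in> space M. Z k \<omega> \<in> {y k}})"
    by auto
  also have "\<dots> \<in> events" by (intro sets.Int sets.finite_INT ev) auto
  finally show ?thesis .
qed

text \<open>The Markov assumption speaks only about complete paths. The induction sums over the next
  value \<open>c\<close>, of which there are countably many, and applies the hypothesis to the path
  prolonged by \<open>c\<close>. This is why the length \<open>l\<close> of the prefix is
  arbitrary.\<close>

lemma emeasure_prefix_generation:
  "emeasure M {\<omega> \<in> space M. (\<forall>k\<le>l. Z k \<omega> = z k) \<and> Z (l + n) \<omega> \<in> B} =
     emeasure M {\<omega> \<in> space M. \<forall>k\<le>l. Z k \<omega> = z k} * emeasure (generation off n (z l)) B"
proof (induction n arbitrary: l z)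
  case 0
  have "{\<omega> \<in> space M. (\<forall>k\<le>l. Z k \<omega> = z k) \<and> Z (l + 0) \<omega> \<in> B} =
      (if z l \<in> B then {\<omega> \<in> space M. \<forall>k\<le>l. Z k \<omega> = z k} else {})" by auto
  thus ?case by (simp add: indicator_def)
next
  case (Suc n)
  let ?E = "\<lambda>c. {\<omega> \<in> space M. (\<forall>k\<le>Suc l. Z k \<omega> = (z(Suc l := c)) k) \<and> Z (Suc l + n) \<omega> \<in> B}"
  have step: "emeasure M {\<omega> \<in> space M. \<forall>k\<le>Suc l. Z k \<omega> = (z(Suc l := c)) k} =
      emeasure M {\<omega> \<in> space M. \<forall>k\<le>l. Z k \<omega> = z k} * ennreal (pmf (next_gen off (z l)) c)" for c
  proof -
    have "(\<forall>k\<le>l. Z k \<omega> = (z(Suc l := c)) k) \<longleftrightarrow> (\<forall>k\<le>l. Z k \<omega> = z k)" for \<omega> by auto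
    thus ?thesis using markov[of l "z(Suc l := c)"]
      by (simp add: emeasure_eq_measure ennreal_mult'')
  qed
  have disj: "disjoint_family ?E"
    unfolding disjoint_family_on_def by (auto dest: spec[of _ "Suc l"])
  have meas: "?E c \<in> sets M" for c by (rule cylinder_in_events)
  have "{\<omega> \<in> space M. (\<forall>k\<le>l. Z k \<omega> = z k) \<and> Z (l + Suc n) \<omega> \<in> B} = (\<Union>c. ?E c)"
    by (auto simp: le_Suc_eq)
  hence "emeasure M {\<omega> \<in> space M. (\<forall>k\<le>l. Z k \<omega> = z k) \<and> Z (l + Suc n) \<omega> \<in> B} =
      emeasure M (\<Union>c. ?E c)"
    by (rule arg_cong)
  also have "\<dots> = (\<integral>\<^sup>+c. emeasure M (?E c) \<partial>count_space UNIV)"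
    using disj meas by (rule emeasure_UN_countable[rotated -1]) (rule countable_UNIV_multiset)
  also have "\<dots> = (\<integral>\<^sup>+c. emeasure M {\<omega> \<in> space M. \<forall>k\<le>l. Z k \<omega> = z k} *
      (ennreal (pmf (next_gen off (z l)) c) * emeasure (generation off n c) B) \<partial>count_space UNIV)"
  proof (rule nn_integral_cong)
    fix c
    show "emeasure M (?E c) = emeasure M {\<omega> \<in> space M. \<forall>k\<le>l. Z k \<omega> = z k} *
        (ennreal (pmf (next_gen off (z l)) c) * emeasure (generation off n c) B)"
    proof -
      have "emeasure M (?E c) = emeasure M {\<omega> \<in> space M. \<forall>k\<le>Suc l. Z k \<omega> = (z(Suc l := c)) k} *
          emeasure (generation off n ((z(Suc l := c)) (Suc l))) B"
        by (rule Suc.IH[of "Suc l" "z(Suc l := c)"])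
      also have "(z(Suc l := c)) (Suc l) = c" by (rule fun_upd_same)
      also note step[of c]
      finally show ?thesis by (simp only: mult.assoc)
    qed
  qed
  also have "\<dots> = emeasure M {\<omega> \<in> space M. \<forall>k\<le>l. Z k \<omega> = z k} *
      (\<integral>\<^sup>+c. emeasure (generation off n c) B \<partial>next_gen off (z l))"
    by (simp add: nn_integral_cmult nn_integral_measure_pmf)
  finally show ?case by simp
qed

text \<open>This removes the probability space: from here on the limits concern the laws
  \<open>generation off n z\<close>.\<close>

lemma cond_prob_start:
  assumes "\<P>(\<omega> in M. Z 0 \<omega> = z) > 0"
  shows "\<P>(\<omega> in M. Z n \<omega> \<in> B \<bar> Z 0 \<omega> = z) = measure (generation off n z) B"
proof -
  have "{\<omega> \<in> space M. (\<forall>k\<le>0. Z k \<omega> = z) \<and> Z (0 + n) \<omega> \<in> B} =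
      {\<omega> \<in> space M. Z n \<omega> \<in> B \<and> Z 0 \<omega> = z}"
    "{\<omega> \<in> space M. \<forall>k\<le>0. Z k \<omega> = z} = {\<omega> \<in> space M. Z 0 \<omega> = z}"
    by auto
  with emeasure_prefix_generation[of 0 "\<lambda>_. z" n B]
  have "\<P>(\<omega> in M. Z n \<omega> \<in> B \<and> Z 0 \<omega> = z) =
      \<P>(\<omega> in M. Z 0 \<omega> = z) * measure (generation off n z) B"
    by (simp add: emeasure_eq_measure measure_pmf.emeasure_eq_measure ennreal_mult''[symmetric])
  thus ?thesis using assms by (simp add: cond_prob_def)
qed

end

section \<open>Power series and convolutions\<close>

text \<open>Convergence at a positive point gives convergence in the whole disc below it, so the sum
  is continuous at 0, and its limit from the right gives \<open>a 0 = 0\<close>. Dividing by t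
  shifts the coefficients and the argument repeats.\<close>

lemma powser_zero_imp_coeff_zero:
  fixes a :: "nat \<Rightarrow> real"
  assumes "\<And>t. 0 < t \<Longrightarrow> t < 1 \<Longrightarrow> (\<lambda>n. a n * t ^ n) sums 0"
  shows "a n = 0"
proof -
  have first: "a 0 = 0" if a: "\<And>t. 0 < t \<Longrightarrow> t < 1 \<Longrightarrow> (\<lambda>n. a n * t ^ n) sums 0" for a :: "nat \<Rightarrow> real"
  proof -
    define f where "f t = (\<Sum>n. a n * t ^ n)" for t
    have sums: "(\<lambda>n. a n * t ^ n) sums f t" if t: "norm t < 1" for t
    proof -
      obtain u where u: "\<bar>t\<bar> < u" "u < 1" using dense[of "\<bar>t\<bar>" 1] t by auto
      have "summable (\<lambda>n. a n * u ^ n)" using a[of u] u by (auto simp: sums_iff)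
      from powser_inside[OF this, of t] show ?thesis
        using u by (auto simp: f_def summable_sums)
    qed
    have "(f \<longlongrightarrow> a 0) (at 0)"
      by (rule powser_limit_0_strong[where s = 1]) (use sums in auto)
    hence "(f \<longlongrightarrow> a 0) (at_right 0)" by (rule filterlim_mono) (auto simp: at_le)
    moreover have "eventually (\<lambda>t. f t = 0) (at_right 0)"
      using eventually_at_right_real[OF zero_less_one]
      by (elim eventually_mono) (auto simp: f_def dest!: a sums_unique)
    hence "(f \<longlongrightarrow> 0) (at_right 0)" by (rule tendsto_eventually)
    ultimately show ?thesis by (intro tendsto_unique[of "at_right (0::real)"]) auto
  qed
  show ?thesis using assms
  proof (induction n arbitrary: a)
    case (Suc n)
    have "(\<lambda>n. a (Suc n) * t ^ n) sums 0" if t: "0 < t" "t < 1" for t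
    proof -
      have "(\<lambda>n. a (Suc n) * t ^ Suc n) sums 0"
        using Suc.prems[OF t] first[OF Suc.prems] by (subst sums_Suc_iff) simp
      from sums_mult[OF this, of "inverse t"] show ?thesis
        using t by (simp add: field_simps)
    qed
    thus ?case by (rule Suc.IH)
  qed (rule first)
qed

lemma pmf_sums_expectation_power:
  fixes p :: "nat pmf"
  assumes "0 \<le> t" "t \<le> 1"
  shows "(\<lambda>n. pmf p n * t ^ n) sums measure_pmf.expectation p (\<lambda>n. t ^ n)"
proof -
  have "integrable (measure_pmf p) (\<lambda>n. t ^ n)"
    by (rule measure_pmf.integrable_const_bound[of _ 1]) (use assms in \<open>auto simp: power_le_one\<close>)
  hence "integrable (count_space UNIV) (\<lambda>n. pmf p n * t ^ n)"
    by (simp add: measure_pmf_eq_density integrable_density)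
  from sums_integral_count_space_nat[OF this] show ?thesis
    by (simp add: measure_pmf_eq_density integral_density)
qed

text \<open>The prescribed generating function is that of a geometric law with modified mass at 0,
  and a generating function on (0,1) determines its coefficients.\<close>

lemma geometric_tail_from_pgf:
  fixes q :: "'a pmf" and N :: "'a \<Rightarrow> nat" and b c :: real
  assumes b: "b \<ge> 0"
    and pgf: "\<And>t. 0 \<le> t \<Longrightarrow> t \<le> 1 \<Longrightarrow>
      measure_pmf.expectation q (\<lambda>z. t ^ N z) = 1 - (1 - t) * c / (1 + (1 - t) * b)"
  shows "measure q {z. N z > k} = c / (1 + b) * (b / (1 + b)) ^ k"
proof -
  define r where "r = b / (1 + b)"
  define e where "e = c / (1 + b)"
  define p where "p = map_pmf N q"
  \<comment> \<open>Found from the answer: \<open>e * r ^ k\<close> is to be the probability of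
    exceeding \<open>k\<close>, so the weights are differences of consecutive tails, and the
    remaining mass \<open>1 - e\<close> sits at 0.\<close>
  define w where "w n = (if n = 0 then 1 - e else e * (r ^ (n - 1) - r ^ n))" for n
  have r: "0 \<le> r" "r < 1" using b by (auto simp: r_def)
  have "pmf p n - w n = 0" for n
  proof (rule powser_zero_imp_coeff_zero[where a = "\<lambda>n. pmf p n - w n"])
    fix t :: real assume t: "0 < t" "t < 1"
    have rt: "\<bar>r * t\<bar> < 1" using r t by (simp add: abs_mult mult_strict_mono[of r 1 t 1, simplified])
    have 0: "(\<lambda>n. r ^ n * t ^ n) sums (1 / (1 - r * t))"
      using geometric_sums[of "r * t"] rt by (simp add: power_mult_distrib)
    have "(\<lambda>n. (r ^ n - r ^ Suc n) * t ^ Suc n) sums ((1 - r) * t * (1 / (1 - r * t)))"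
      using sums_mult[OF 0, of "(1 - r) * t"] by (simp add: algebra_simps)
    from sums_mult[OF this, of e]
    have "(\<lambda>n. w (Suc n) * t ^ Suc n) sums (e * ((1 - r) * t * (1 / (1 - r * t))))"
      by (simp add: w_def mult.assoc)
    hence "(\<lambda>n. w n * t ^ n) sums (e * ((1 - r) * t * (1 / (1 - r * t))) + (1 - e))"
      by (subst (asm) sums_Suc_iff) (simp add: w_def)
    moreover have "e * ((1 - r) * t * (1 / (1 - r * t))) + (1 - e) =
        1 - (1 - t) * c / (1 + (1 - t) * b)"
    proof -
      have den: "1 + (1 - t) * b = (1 + b) * (1 - r * t)"
        using b by (simp add: r_def field_simps)
      have 1: "(1 - t) * c / (1 + (1 - t) * b) = (1 - t) * e / (1 - r * t)"
        unfolding den e_def using b by simp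
      have "e * ((1 - r) * t * (1 / (1 - r * t))) + (1 - e) = 1 - (1 - t) * e / (1 - r * t)"
        using rt by (simp add: field_simps)
      thus ?thesis by (simp only: 1)
    qed
    ultimately have "(\<lambda>n. w n * t ^ n) sums measure_pmf.expectation p (\<lambda>n. t ^ n)"
      using pgf[of t] t by (simp only: p_def integral_map_pmf)
    from sums_diff[OF pmf_sums_expectation_power[of t p] this]
    show "(\<lambda>n. (pmf p n - w n) * t ^ n) sums 0"
      using t by (simp add: algebra_simps)
  qed
  hence w: "pmf p n = w n" for n by simp
  have "(\<Sum>n\<le>k. w n) = 1 - e * r ^ k"
    by (induction k) (auto simp: w_def algebra_simps)
  hence "measure p {..k} = 1 - e * r ^ k"
    by (simp add: measure_measure_pmf_finite w)
  hence "measure p (- {..k}) = e * r ^ k"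
    using measure_pmf.prob_compl[of "{..k}" p] by (simp add: Compl_eq_Diff_UNIV)
  moreover have "N -` (- {..k}) = {z. N z > k}" by auto
  ultimately show ?thesis by (simp add: p_def e_def r_def)
qed

text \<open>For fixed k the index n - k tends to infinity, so each term converges. The bound by a
  multiple of \<open>\<bar>b k\<bar>\<close> allows the limit to be taken under the sum.\<close>

lemma convolution_tendsto:
  fixes b s :: "nat \<Rightarrow> real"
  assumes b: "summable (\<lambda>k. \<bar>b k\<bar>)" and s: "s \<longlonglongrightarrow> L"
  shows "(\<lambda>n. \<Sum>k\<le>n. b k * s (n - k)) \<longlonglongrightarrow> (\<Sum>k. b k) * L"
proof -
  obtain S where S: "\<And>n. \<bar>s n\<bar> \<le> S"
    using convergent_imp_Bseq[OF convergentI[OF s]] by (auto simp: Bseq_def)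
  define f where "f k n = (if k \<le> n then b k * s (n - k) else 0)" for k n
  have "(\<lambda>n. \<Sum>k. f k n) \<longlonglongrightarrow> (\<Sum>k. b k * L)"
  proof (rule tannerys_theorem[THEN conjunct2, THEN conjunct2])
    show "((\<lambda>n. f k n) \<longlongrightarrow> b k * L) sequentially" for k
    proof (rule Lim_transform_eventually)
      show "(\<lambda>n. b k * s (n - k)) \<longlonglongrightarrow> b k * L"
        by (intro tendsto_mult tendsto_const filterlim_compose[OF s]) (rule filterlim_minus_const_nat_at_top)
      show "eventually (\<lambda>n. b k * s (n - k) = f k n) sequentially"
        using eventually_ge_at_top[of k] by eventually_elim (simp add: f_def)
    qed
    have "\<bar>f k n\<bar> \<le> \<bar>b k\<bar> * S" for k n
      using mult_left_mono[OF S, of "\<bar>b k\<bar>" "n - k"] S[of 0] by (auto simp: f_def abs_mult)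
    thus "eventually (\<lambda>(k, n). norm (f k n) \<le> \<bar>b k\<bar> * S) (at_top \<times>\<^sub>F sequentially)"
      by (auto intro!: always_eventually)
    show "summable (\<lambda>k. \<bar>b k\<bar> * S)" using b by (rule summable_mult2)
  qed auto
  moreover have "(\<Sum>k. f k n) = (\<Sum>k\<le>n. b k * s (n - k))" for n
    by (subst suminf_finite[of "{..n}"]) (auto simp: f_def)
  moreover have "(\<Sum>k. b k * L) = (\<Sum>k. b k) * L"
    using b by (intro suminf_mult2[symmetric]) (auto intro: summable_norm_cancel)
  ultimately show ?thesis by simp
qed

section \<open>Substochastic matrices acting on bounded vectors\<close>

text \<open>One notion for the rows of \<open>H\<close>, for \<open>g\<close>, and later for the
  weights (1 - R) R^k, so that the facts about \<open>dot\<close> serve all three.\<close>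

definition subprob_vec :: "(nat \<Rightarrow> real) \<Rightarrow> bool" where
  "subprob_vec h \<longleftrightarrow> (\<forall>i. 0 \<le> h i) \<and> summable h \<and> suminf h \<le> 1"

lemma substochastic_iff: "substochastic P \<longleftrightarrow> (\<forall>i. subprob_vec (P i))"
  by (auto simp: substochastic_def subprob_vec_def)

lemma prob_vec_imp_subprob_vec: "prob_vec g \<Longrightarrow> subprob_vec g"
  by (auto simp: prob_vec_def subprob_vec_def sums_iff)

lemma bounded_rangeE:
  fixes x :: "nat \<Rightarrow> real"
  assumes "bounded (range x)"
  obtains C where "C \<ge> 0" "\<And>i. \<bar>x i\<bar> \<le> C"
proof -
  from assms obtain C where "\<And>i. \<bar>x i\<bar> \<le> C" by (auto simp: bounded_iff)
  thus ?thesis using that[of C] abs_ge_zero[of "x 0"] by (meson order_trans)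
qed

lemma bounded_rangeI: "(\<And>i. \<bar>x i\<bar> \<le> C) \<Longrightarrow> bounded (range x)" for x :: "nat \<Rightarrow> real"
  by (auto simp: bounded_iff)

lemma bounded_add_range:
  fixes x y :: "nat \<Rightarrow> real"
  assumes "bounded (range x)" "bounded (range y)"
  shows "bounded (range (\<lambda>i. x i + y i))"
  using bounded_plus_comp[OF assms] .

lemma bounded_scale_range:
  fixes x :: "nat \<Rightarrow> real"
  assumes "bounded (range x)"
  shows "bounded (range (\<lambda>i. c * x i))"
  using bounded_scaleR_comp[OF assms, of c] by simp

lemma bounded_sum_range:
  fixes x :: "'k \<Rightarrow> nat \<Rightarrow> real"
  assumes "\<And>k. k \<in> F \<Longrightarrow> bounded (range (x k))"
  shows "bounded (range (\<lambda>i. \<Sum>k\<in>F. x k i))"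
  using assms by (induction F rule: infinite_finite_induct) (auto intro!: bounded_add_range)

lemma dot_summable:
  assumes h: "subprob_vec h" and x: "bounded (range x)"
  shows "summable (\<lambda>i. \<bar>h i * x i\<bar>)" "summable (\<lambda>i. h i * x i)"
proof -
  obtain C where C: "C \<ge> 0" "\<And>i. \<bar>x i\<bar> \<le> C" using bounded_rangeE[OF x] by blast
  show "summable (\<lambda>i. \<bar>h i * x i\<bar>)"
  proof (rule summable_comparison_test'[where N = 0])
    show "summable (\<lambda>i. h i * C)" using h by (intro summable_mult2) (simp add: subprob_vec_def)
    show "norm \<bar>h i * x i\<bar> \<le> h i * C" for i
      using h C by (auto simp: subprob_vec_def abs_mult intro!: mult_left_mono)
  qed
  thus "summable (\<lambda>i. h i * x i)" by (rule summable_rabs_cancel)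
qed

lemma dot_mono:
  assumes h: "subprob_vec h" and "bounded (range x)" "bounded (range y)" and "\<And>i. x i \<le> y i"
  shows "dot h x \<le> dot h y"
  unfolding dot_def using assms
  by (intro suminf_le dot_summable) (auto simp: subprob_vec_def intro!: mult_left_mono)

lemma dot_const_le:
  assumes h: "subprob_vec h" and "C \<ge> 0"
  shows "dot h (\<lambda>_. C) \<le> C"
proof -
  have "dot h (\<lambda>_. C) = suminf h * C"
    unfolding dot_def using h by (subst suminf_mult2) (auto simp: subprob_vec_def)
  also have "\<dots> \<le> 1 * C"
    using h \<open>C \<ge> 0\<close> by (intro mult_right_mono) (auto simp: subprob_vec_def)
  finally show ?thesis by simp
qed

lemma dot_add:
  assumes "subprob_vec h" "bounded (range x)" "bounded (range y)"
  shows "dot h (\<lambda>i. x i + y i) = dot h x + dot h y"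
  unfolding dot_def using dot_summable(2)[OF assms(1,2)] dot_summable(2)[OF assms(1,3)]
  by (simp add: suminf_add ring_distribs)

lemma dot_scale:
  assumes "subprob_vec h" "bounded (range x)"
  shows "dot h (\<lambda>i. c * x i) = c * dot h x"
  unfolding dot_def using suminf_mult[OF dot_summable(2)[OF assms], of c]
  by (simp add: mult_ac)

lemma dot_nonneg:
  assumes "subprob_vec h" "bounded (range x)" "\<And>i. 0 \<le> x i"
  shows "0 \<le> dot h x"
  unfolding dot_def using assms
  by (intro suminf_nonneg dot_summable) (auto simp: subprob_vec_def)

lemma abs_dot_le:
  assumes h: "subprob_vec h" and C: "\<And>i. \<bar>x i\<bar> \<le> C"
  shows "\<bar>dot h x\<bar> \<le> C"
proof -
  have C0: "C \<ge> 0" using C[of 0] by simp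
  have bx: "bounded (range x)" using C by (rule bounded_rangeI)
  have "dot h x \<le> dot h (\<lambda>_. C)"
    using C by (intro dot_mono h bx) (auto simp: abs_le_iff)
  moreover have "dot h (\<lambda>i. - 1 * x i) \<le> dot h (\<lambda>_. C)"
    using C bx by (intro dot_mono h bounded_scale_range) (auto simp: abs_le_iff minus_le_iff)
  ultimately show ?thesis
    using dot_const_le[OF h C0] dot_scale[OF h bx, of "-1"] by auto
qed

lemma dot_sum:
  assumes h: "subprob_vec h" and x: "\<And>k. k \<in> F \<Longrightarrow> bounded (range (x k))"
  shows "dot h (\<lambda>i. \<Sum>k\<in>F. c k * x k i) = (\<Sum>k\<in>F. c k * dot h (x k))"
  using x
proof (induction F rule: infinite_finite_induct)
  case (insert k F)
  have "dot h (\<lambda>i. c k * x k i + (\<Sum>k\<in>F. c k * x k i)) =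
      dot h (\<lambda>i. c k * x k i) + dot h (\<lambda>i. \<Sum>k\<in>F. c k * x k i)"
    using insert.prems by (intro dot_add h bounded_scale_range bounded_sum_range) auto
  thus ?case using insert by (simp add: dot_scale[OF h])
qed (auto simp: dot_def)

text \<open>Fubini for absolutely convergent double series. The iterated \<open>suminf\<close> is
  rewritten as an unconditional sum over pairs, where the order is immaterial.\<close>

lemma suminf_swap:
  fixes f :: "nat \<Rightarrow> nat \<Rightarrow> real"
  assumes 1: "\<And>i. summable (\<lambda>j. \<bar>f i j\<bar>)" and 2: "summable (\<lambda>i. \<Sum>j. \<bar>f i j\<bar>)"
  shows "summable (\<lambda>j. \<Sum>i. f i j)" "\<And>j. summable (\<lambda>i. f i j)"
    "(\<Sum>j. \<Sum>i. f i j) = (\<Sum>i. \<Sum>j. f i j)"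
proof -
  have inf: "infsum g UNIV = suminf g" if "summable (\<lambda>i. \<bar>g i\<bar>)" for g :: "nat \<Rightarrow> real"
    by (rule infsumI, rule norm_summable_imp_has_sum) (use that in \<open>auto intro: summable_sums summable_rabs_cancel\<close>)
  have "(\<lambda>p. norm (case p of (i, j) \<Rightarrow> f i j)) summable_on UNIV \<times> UNIV"
    using 1 2
    by (subst Infinite_Sum.abs_summable_on_Sigma_iff)
       (auto simp: inf summable_on_UNIV_nonneg_real_iff suminf_nonneg)
  hence abs: "(\<lambda>p. norm (case p of (i, j) \<Rightarrow> f i j)) summable_on UNIV" by simp
  hence "(\<lambda>p. norm (case p of (j, i) \<Rightarrow> f i j)) summable_on UNIV \<times> UNIV"
    using summable_on_reindex_bij_betw[of prod.swap UNIV UNIV "\<lambda>x. norm (case x of (i, j) \<Rightarrow> f i j)"]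
    by (simp add: case_prod_unfold bij_swap)
  note this[unfolded Infinite_Sum.abs_summable_on_Sigma_iff, simplified]
  hence 3: "\<And>j. summable (\<lambda>i. \<bar>f i j\<bar>)" and 4: "summable (\<lambda>j. \<Sum>i. \<bar>f i j\<bar>)"
    by (auto simp: inf summable_on_UNIV_nonneg_real_iff suminf_nonneg infsum_nonneg)
  show 5: "\<And>j. summable (\<lambda>i. f i j)" using 3 by (rule summable_rabs_cancel)
  have 6: "summable (\<lambda>j. \<bar>\<Sum>i. f i j\<bar>)"
    by (rule summable_comparison_test'[OF 4, of 0]) (use 3 in \<open>auto intro!: summable_rabs\<close>)
  thus "summable (\<lambda>j. \<Sum>i. f i j)" by (rule summable_rabs_cancel)
  have 7: "summable (\<lambda>i. \<bar>\<Sum>j. f i j\<bar>)"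
    by (rule summable_comparison_test'[OF 2, of 0]) (use 1 in \<open>auto intro!: summable_rabs\<close>)
  have "infsum (\<lambda>i. infsum (\<lambda>j. f i j) UNIV) UNIV = infsum (\<lambda>j. infsum (\<lambda>i. f i j) UNIV) UNIV"
    using abs_summable_summable[OF abs] by (intro infsum_swap_banach) simp
  thus "(\<Sum>j. \<Sum>i. f i j) = (\<Sum>i. \<Sum>j. f i j)"
    using 1 3 6 7 by (simp add: inf)
qed

lemma mat_vec_eq_dot: "mat_vec P x i = dot (P i) x"
  by (simp add: mat_vec_def dot_def)

lemma bounded_mat_vec:
  assumes "substochastic P" "\<And>i. \<bar>x i\<bar> \<le> C"
  shows "\<bar>mat_vec P x i\<bar> \<le> C"
  using assms by (auto simp: mat_vec_eq_dot substochastic_iff intro: abs_dot_le)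

text \<open>Associativity of h P x for infinite sums. The double series is dominated by the summable
  \<open>h j * C\<close>, where \<open>C\<close> bounds \<open>x\<close> and the rows of
  \<open>P\<close> have mass at most 1.\<close>

lemma vec_mat_swap:
  assumes h: "subprob_vec h" and P: "substochastic P" and x: "bounded (range x)"
  shows "summable (\<lambda>k. vec_mat h P k * x k)"
    "dot (vec_mat h P) x = dot h (mat_vec P x)"
    "summable (\<lambda>j. h j * P j k)"
proof -
  obtain C where C: "C \<ge> 0" "\<And>i. \<bar>x i\<bar> \<le> C" using bounded_rangeE[OF x] by blast
  have P': "subprob_vec (P i)" for i using P by (simp add: substochastic_iff)
  show s: "summable (\<lambda>j. h j * P j k)" for k
  proof (rule dot_summable[OF h], rule bounded_rangeI[where C = 1])
    fix j
    have "P j k \<le> suminf (P j)"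
      using P'[of j] sum_le_suminf[of "P j" "{k}"] by (auto simp: subprob_vec_def)
    thus "\<bar>P j k\<bar> \<le> 1" using P'[of j] by (simp add: subprob_vec_def)
  qed
  define f where "f j k = h j * (P j k * x k)" for j k
  have 1: "summable (\<lambda>k. \<bar>f j k\<bar>)" for j
    using summable_mult[OF dot_summable(1)[OF P' x], of "\<bar>h j\<bar>"] by (simp add: f_def abs_mult)
  have 2: "summable (\<lambda>j. \<Sum>k. \<bar>f j k\<bar>)"
  proof (rule summable_comparison_test'[where N = 0])
    show "summable (\<lambda>j. h j * C)" using h by (intro summable_mult2) (simp add: subprob_vec_def)
    fix j
    have "(\<Sum>k. \<bar>f j k\<bar>) = \<bar>h j\<bar> * dot (P j) (\<lambda>k. \<bar>x k\<bar>)"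
      unfolding dot_def
      using P'[of j] dot_summable(1)[OF P' x, of j]
      by (subst suminf_mult[symmetric]) (auto simp: f_def abs_mult subprob_vec_def)
    also have "\<dots> \<le> \<bar>h j\<bar> * C"
      using abs_dot_le[OF P', of "\<lambda>k. \<bar>x k\<bar>" C j] C by (intro mult_left_mono) auto
    finally show "norm (\<Sum>k. \<bar>f j k\<bar>) \<le> h j * C"
      using h by (simp add: subprob_vec_def suminf_nonneg[OF 1])
  qed
  have v: "vec_mat h P k * x k = (\<Sum>j. f j k)" for k
    unfolding vec_mat_def using suminf_mult2[OF s[of k], of "x k"] by (simp add: f_def mult_ac)
  show "summable (\<lambda>k. vec_mat h P k * x k)"
    unfolding v using 1 2 by (rule suminf_swap)
  have "dot (vec_mat h P) x = (\<Sum>j. \<Sum>k. f j k)"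
    unfolding dot_def v using 1 2 by (rule suminf_swap)
  also have "\<dots> = dot h (mat_vec P x)"
    unfolding dot_def mat_vec_def f_def
    using dot_summable(2)[OF P' x] by (simp add: suminf_mult)
  finally show "dot (vec_mat h P) x = dot h (mat_vec P x)" .
qed

lemma subprob_vec_vec_mat:
  assumes h: "subprob_vec h" and P: "substochastic P"
  shows "subprob_vec (vec_mat h P)"
proof -
  have one: "bounded (range one_vec)" by (auto simp: one_vec_def)
  have "0 \<le> vec_mat h P k" for k
    unfolding vec_mat_def using vec_mat_swap(3)[OF assms one] h P
    by (intro suminf_nonneg) (auto simp: subprob_vec_def substochastic_def)
  moreover have "summable (vec_mat h P)"
    using vec_mat_swap(1)[OF assms one] by (simp add: one_vec_def)
  moreover have "suminf (vec_mat h P) \<le> 1"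
    using vec_mat_swap(2)[OF assms one] abs_dot_le[OF h, of "mat_vec P one_vec" 1]
      bounded_mat_vec[OF P, of one_vec 1]
    by (auto simp: dot_def one_vec_def)
  ultimately show ?thesis by (simp add: subprob_vec_def)
qed

lemma substochastic_mat_pow: "substochastic H \<Longrightarrow> substochastic (mat_pow H n)"
proof (induction n)
  case 0
  have "(\<lambda>j. if i = j then 1 else 0 :: real) sums 1" for i :: nat
    using sums_single[of i "\<lambda>_. 1 :: real"] by (simp add: eq_commute)
  thus ?case by (auto simp: substochastic_iff subprob_vec_def sums_iff)
next
  case (Suc n)
  have "mat_pow H (Suc n) i = vec_mat (H i) (mat_pow H n)" for i
    by (simp add: mat_mult_def vec_mat_def fun_eq_iff)
  thus ?case using Suc by (auto simp: substochastic_iff subprob_vec_vec_mat)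
qed

text \<open>The bridge between the matrix powers in the definitions of d, u and v and the iterates
  of an operator on bounded vectors with which the asymptotics are done.\<close>

lemma mat_vec_mat_pow:
  assumes H: "substochastic H" and x: "bounded (range x)"
  shows "mat_vec (mat_pow H n) x = (mat_vec H ^^ n) x"
proof (induction n)
  case 0
  have "(\<lambda>j. (if i = j then 1 else 0) * x j) sums x i" for i
    by (rule sums_single[of i x, THEN back_subst[where P = "\<lambda>f. f sums x i"]]) auto
  thus ?case by (auto simp: mat_vec_def fun_eq_iff sums_iff)
next
  case (Suc n)
  have "mat_pow H (Suc n) i = vec_mat (H i) (mat_pow H n)" for i
    by (simp add: mat_mult_def vec_mat_def fun_eq_iff)
  hence "mat_vec (mat_pow H (Suc n)) x i = mat_vec H (mat_vec (mat_pow H n) x) i" for i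
    using vec_mat_swap(2)[OF _ substochastic_mat_pow[OF H] x, of "H i" n] H
    by (simp add: mat_vec_eq_dot substochastic_iff del: mat_pow.simps)
  thus ?case by (auto simp: Suc)
qed

section \<open>Iterated linear-fractional generating functions\<close>

text \<open>The action of \<open>M\<close> with its rank-one part kept apart: that part sees
  \<open>x\<close> only through the scalar \<open>dot g x\<close>.\<close>

definition mean_op :: "(nat \<Rightarrow> nat \<Rightarrow> real) \<Rightarrow> (nat \<Rightarrow> real) \<Rightarrow> real \<Rightarrow> (nat \<Rightarrow> real) \<Rightarrow> nat \<Rightarrow> real" where
  "mean_op H g m x i = mat_vec H x i + m * dot g x * mat_vec H one_vec i"

locale lf_parameters =
  fixes H :: "nat \<Rightarrow> nat \<Rightarrow> real" and g :: "nat \<Rightarrow> real" and m :: real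
  assumes substochastic_H: "substochastic H" and prob_vec_g: "prob_vec g" and m_pos: "m > 0"
begin

lemma H_row: "subprob_vec (H i)"
  using substochastic_H by (simp add: substochastic_iff)

lemma g_subprob: "subprob_vec g"
  using prob_vec_g by (rule prob_vec_imp_subprob_vec)

lemma bounded_one_vec: "bounded (range one_vec)"
  by (auto simp: one_vec_def)

lemma abs_mat_vec_pow_le:
  assumes "\<And>i. \<bar>x i\<bar> \<le> C"
  shows "\<bar>(mat_vec H ^^ n) x i\<bar> \<le> C"
  using assms
proof (induction n arbitrary: i)
  case (Suc n)
  thus ?case using bounded_mat_vec[OF substochastic_H, of "(mat_vec H ^^ n) x" C i] by simp
qed simp

lemma bounded_mat_vec_pow: "bounded (range x) \<Longrightarrow> bounded (range ((mat_vec H ^^ n) x))"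
  by (metis abs_mat_vec_pow_le bounded_rangeE bounded_rangeI)

lemma mat_vec_pow_nonneg:
  assumes "bounded (range x)" "\<And>i. 0 \<le> x i"
  shows "0 \<le> (mat_vec H ^^ n) x i"
  using assms
proof (induction n arbitrary: i)
  case (Suc n)
  thus ?case using dot_nonneg[OF H_row bounded_mat_vec_pow[of x n], of i]
    by (simp add: mat_vec_eq_dot[of H "(mat_vec H ^^ n) x"])
qed simp

lemma bounded_mat_vec_range: "bounded (range x) \<Longrightarrow> bounded (range (mat_vec H x))"
  using bounded_mat_vec_pow[of x 1] by simp

lemma bounded_mean_op: "bounded (range x) \<Longrightarrow> bounded (range (mean_op H g m x))"
  unfolding mean_op_def
  by (intro bounded_add_range bounded_scale_range bounded_mat_vec_range bounded_one_vec)

lemma bounded_mean_op_pow: "bounded (range x) \<Longrightarrow> bounded (range ((mean_op H g m ^^ n) x))"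
  by (induction n) (auto intro: bounded_mean_op)

lemma mean_op_nonneg:
  assumes "bounded (range x)" "\<And>i. 0 \<le> x i"
  shows "0 \<le> mean_op H g m x i"
  using dot_nonneg[OF H_row assms] dot_nonneg[OF g_subprob assms] m_pos
    dot_nonneg[OF H_row bounded_one_vec]
  by (auto simp: mean_op_def mat_vec_eq_dot one_vec_def)

lemma mean_op_pow_nonneg:
  assumes "bounded (range x)" "\<And>i. 0 \<le> x i"
  shows "0 \<le> (mean_op H g m ^^ n) x i"
proof (induction n arbitrary: i)
  case (Suc n)
  thus ?case using mean_op_nonneg[OF bounded_mean_op_pow[OF assms(1)]] by simp
qed (use assms in auto)

lemma mean_op_lincomb:
  assumes "bounded (range x)" "bounded (range y)"
  shows "mean_op H g m (\<lambda>i. a * x i + b * y i) = (\<lambda>i. a * mean_op H g m x i + b * mean_op H g m y i)"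
proof -
  have "dot h (\<lambda>i. a * x i + b * y i) = a * dot h x + b * dot h y" if "subprob_vec h" for h
    using that assms by (simp add: dot_add dot_scale bounded_scale_range)
  from this[OF H_row] this[OF g_subprob] show ?thesis
    by (auto simp: mean_op_def mat_vec_eq_dot fun_eq_iff algebra_simps)
qed

lemma mean_op_pow_lincomb:
  assumes "bounded (range x)" "bounded (range y)"
  shows "(mean_op H g m ^^ n) (\<lambda>i. a * x i + b * y i) =
    (\<lambda>i. a * (mean_op H g m ^^ n) x i + b * (mean_op H g m ^^ n) y i)"
  using assms by (induction n) (simp_all add: mean_op_lincomb bounded_mean_op_pow)

lemma mean_op_scale:
  assumes "bounded (range x)"
  shows "mean_op H g m (\<lambda>i. c * x i) = (\<lambda>i. c * mean_op H g m x i)"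
  using mean_op_lincomb[OF assms assms, of c 0] by simp

definition renewal :: "(nat \<Rightarrow> real) \<Rightarrow> nat \<Rightarrow> real" where
  "renewal x n = dot g ((mean_op H g m ^^ n) x)"

lemma renewal_nonneg: "bounded (range x) \<Longrightarrow> (\<And>i. 0 \<le> x i) \<Longrightarrow> 0 \<le> renewal x n"
  unfolding renewal_def by (intro dot_nonneg g_subprob bounded_mean_op_pow mean_op_pow_nonneg)

lemma renewal_lincomb:
  assumes "bounded (range x)" "bounded (range y)"
  shows "renewal (\<lambda>i. a * x i + b * y i) n = a * renewal x n + b * renewal y n"
  unfolding renewal_def mean_op_pow_lincomb[OF assms]
  using assms by (simp add: dot_add[OF g_subprob] dot_scale[OF g_subprob] bounded_scale_range bounded_mean_op_pow)

text \<open>Since \<open>g\<close> has mass 1, substituting s = 1 - x turns the denominator into 1 +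
  m (g x). Bringing the constant term of the generating function over this denominator adds m (g x)
  H 1 to H x, which is exactly M x.\<close>

lemma offspring_pgf_LF:
  assumes LF: "has_LF (off i) (H i) g m" and x: "\<And>j. 0 \<le> x j" "\<And>j. x j \<le> 1"
  shows "offspring_pgf off (\<lambda>j. 1 - x j) i = 1 - mean_op H g m x i / (1 + m * dot g x)"
proof -
  have bx: "bounded (range x)" by (rule bounded_rangeI[where C = 1]) (use x in \<open>simp add: abs_le_iff add_nonneg_nonneg\<close>)
  have s: "(\<Sum>j. h j * (1 - x j)) = suminf h - dot h x" if "subprob_vec h" for h
    using that dot_summable(2)[OF that bx]
    by (simp add: dot_def right_diff_distrib suminf_diff subprob_vec_def)
  have g1: "suminf g = 1" using prob_vec_g by (simp add: prob_vec_def sums_iff)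
  have H1: "suminf (H i) = mat_vec H one_vec i" by (simp add: mat_vec_def one_vec_def)
  have pos: "1 + m * dot g x > 0"
    using dot_nonneg[OF g_subprob bx x(1)] m_pos by (simp add: add_pos_nonneg)
  have "offspring_pgf off (\<lambda>j. 1 - x j) i =
      (1 - suminf (H i)) + (\<Sum>j. H i j * (1 - x j)) / (1 + m - m * (\<Sum>j. g j * (1 - x j)))"
    using LF x unfolding has_LF_def offspring_pgf_def by auto
  also have "\<dots> = 1 - mean_op H g m x i / (1 + m * dot g x)"
    unfolding s[OF H_row] s[OF g_subprob] g1 mean_op_def H1 mat_vec_eq_dot[of H x]
    using pos by (simp add: field_simps)
  finally show ?thesis .
qed

text \<open>A projective map composes by homogeneity: with y = M^n x it sends y / D to M y / (D + m
  (g y)). The numerator is iterated linearly, and the denominator merely accumulates the terms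
  \<open>m * renewal x n\<close>.\<close>

lemma offspring_pgf_iterate_LF:
  assumes LF: "\<And>i. has_LF (off i) (H i) g m" and x: "\<And>j. 0 \<le> x j" "\<And>j. x j \<le> 1"
  shows "(offspring_pgf off ^^ n) (\<lambda>j. 1 - x j) i =
    1 - (mean_op H g m ^^ n) x i / (1 + m * (\<Sum>k<n. renewal x k))"
proof (induction n arbitrary: i)
  case (Suc n)
  have bx: "bounded (range x)" by (rule bounded_rangeI[where C = 1]) (use x in \<open>simp add: abs_le_iff add_nonneg_nonneg\<close>)
  define D where "D = 1 + m * (\<Sum>k<n. renewal x k)"
  define y where "y = (mean_op H g m ^^ n) x"
  have D: "D > 0" unfolding D_def
    using m_pos renewal_nonneg[OF bx x(1)] by (intro add_pos_nonneg) (auto intro!: mult_nonneg_nonneg sum_nonneg)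
  have bdy: "bounded (range y)" unfolding y_def using bx by (rule bounded_mean_op_pow)
  have IH: "(offspring_pgf off ^^ n) (\<lambda>j. 1 - x j) = (\<lambda>j. 1 - inverse D * y j)"
    using Suc.IH by (auto simp: D_def y_def field_simps)
  \<comment> \<open>These bounds hold because \<open>1 - inverse D * y j\<close> is an iterated
    generating function evaluated inside the unit cube; estimating \<open>y\<close> and
    \<open>D\<close> separately would not give them.\<close>
  have u: "0 \<le> inverse D * y j" "inverse D * y j \<le> 1" for j
    using offspring_pgf_iterate_unit_interval[of "\<lambda>j. 1 - x j" n off j] x IH by auto
  have "(offspring_pgf off ^^ Suc n) (\<lambda>j. 1 - x j) i = offspring_pgf off (\<lambda>j. 1 - inverse D * y j) i"
    by (simp add: IH)
  also have "\<dots> = 1 - inverse D * mean_op H g m y i / (1 + m * (inverse D * dot g y))"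
    using u by (subst offspring_pgf_LF[OF LF]) (auto simp: mean_op_scale[OF bdy] dot_scale[OF g_subprob bdy])
  also have "inverse D * mean_op H g m y i / (1 + m * (inverse D * dot g y)) =
      mean_op H g m y i / (D + m * dot g y)"
    using D by (simp add: field_simps)
  also have "D + m * dot g y = 1 + m * (\<Sum>k<Suc n. renewal x k)"
    by (simp add: D_def y_def renewal_def algebra_simps)
  finally show ?case by (simp add: y_def)
qed (simp add: field_simps)

lemma expectation_generation_LF:
  assumes LF: "\<And>i. has_LF (off i) (H i) g m" and x: "\<And>j. 0 \<le> x j" "\<And>j. x j \<le> 1"
  shows "measure_pmf.expectation (generation off n {#i#}) (\<lambda>z. \<Prod>j\<in>#z. 1 - x j) =
    1 - (mean_op H g m ^^ n) x i / (1 + m * (\<Sum>k<n. renewal x k))"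
  using expectation_generation[of "\<lambda>j. 1 - x j" off n "{#i#}"] x
  by (simp add: offspring_pgf_iterate_LF[OF LF x])

text \<open>For s constantly equal to t, linearity pulls the factor 1 - t out of the numerator and
  of every term of the denominator. For \<open>k = 0\<close> the formula is the survival
  probability.\<close>

lemma generation_size_tail:
  assumes LF: "\<And>i. has_LF (off i) (H i) g m"
  shows "measure (generation off n {#i#}) {z. size z > k} =
    (let B = m * (\<Sum>k<n. renewal one_vec k)
     in (mean_op H g m ^^ n) one_vec i / (1 + B) * (B / (1 + B)) ^ k)"
  unfolding Let_def
proof (rule geometric_tail_from_pgf)
  show "0 \<le> m * (\<Sum>k<n. renewal one_vec k)"
    using m_pos renewal_nonneg[OF bounded_one_vec]
    by (auto intro!: mult_nonneg_nonneg sum_nonneg simp: one_vec_def)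
  fix t :: real assume t: "0 \<le> t" "t \<le> 1"
  define x :: "nat \<Rightarrow> real" where "x j = (1 - t) * one_vec j" for j
  have p: "(\<Prod>j\<in>#z. 1 - x j) = t ^ size z" for z
    by (induction z) (auto simp: x_def one_vec_def)
  have M: "(mean_op H g m ^^ n) x i = (1 - t) * (mean_op H g m ^^ n) one_vec i" for n i
    using mean_op_pow_lincomb[OF bounded_one_vec bounded_one_vec, of n "1 - t" 0]
    by (simp add: x_def[abs_def])
  have r: "renewal x k = (1 - t) * renewal one_vec k" for k
    using renewal_lincomb[OF bounded_one_vec bounded_one_vec, of "1 - t" 0]
    by (simp add: x_def[abs_def])
  show "measure_pmf.expectation (generation off n {#i#}) (\<lambda>z. t ^ size z) =
      1 - (1 - t) * (mean_op H g m ^^ n) one_vec i /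
        (1 + (1 - t) * (m * (\<Sum>k<n. renewal one_vec k)))"
    using expectation_generation_LF[OF LF, where x = x] t
    by (simp add: p M r x_def one_vec_def sum_distrib_left mult_ac)
qed

lemma lf_d_eq: "lf_d H g n = dot g ((mat_vec H ^^ n) one_vec)"
  unfolding lf_d_def
  using vec_mat_swap(2)[OF g_subprob substochastic_mat_pow[OF substochastic_H] bounded_one_vec]
  by (simp add: mat_vec_mat_pow[OF substochastic_H bounded_one_vec])

lemma mat_vec_pow_one_unit_interval:
  "0 \<le> (mat_vec H ^^ n) one_vec i" "(mat_vec H ^^ n) one_vec i \<le> 1"
  using mat_vec_pow_nonneg[OF bounded_one_vec, of n i] abs_mat_vec_pow_le[of one_vec 1 n i]
  by (auto simp: one_vec_def)

lemma lf_d_unit_interval: "0 \<le> lf_d H g n" "lf_d H g n \<le> 1"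
  unfolding lf_d_eq
  using dot_nonneg[OF g_subprob bounded_mat_vec_pow[OF bounded_one_vec, of n]]
    abs_dot_le[OF g_subprob, of "(mat_vec H ^^ n) one_vec" 1] mat_vec_pow_one_unit_interval[of n]
  by auto

text \<open>H 1 is at most 1, and \<open>H\<close> preserves the order.\<close>

lemma lf_d_antimono: "lf_d H g (Suc n) \<le> lf_d H g n"
proof -
  have le: "(mat_vec H ^^ Suc n) one_vec i \<le> (mat_vec H ^^ n) one_vec i" for n i
  proof (induction n arbitrary: i)
    case 0
    show ?case using mat_vec_pow_one_unit_interval(2)[of 1 i] by (simp add: one_vec_def)
  next
    case (Suc n)
    show ?case
      using dot_mono[OF H_row bounded_mat_vec_pow[OF bounded_one_vec, of "Suc n"]
          bounded_mat_vec_pow[OF bounded_one_vec, of n] Suc.IH, of i]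
      by (simp add: mat_vec_eq_dot)
  qed
  show ?thesis unfolding lf_d_eq
    by (intro dot_mono g_subprob bounded_mat_vec_pow bounded_one_vec le)
qed

text \<open>A Duhamel formula: the rank-one part applied at step n - 1 - k injects
  \<open>m * renewal x (n - 1 - k)\<close> copies of H 1, which are then carried on by
  \<open>H\<close> alone for k further steps.\<close>

lemma mean_op_pow_expansion:
  assumes x: "bounded (range x)"
  shows "(mean_op H g m ^^ n) x i =
    (mat_vec H ^^ n) x i + m * (\<Sum>k<n. (mat_vec H ^^ Suc k) one_vec i * renewal x (n - 1 - k))"
proof (induction n arbitrary: i)
  case (Suc n)
  have b: "bounded (range ((mat_vec H ^^ k) one_vec))" for k
    by (intro bounded_mat_vec_pow bounded_one_vec)
  have IH: "(mean_op H g m ^^ n) x = (\<lambda>i. (mat_vec H ^^ n) x i +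
      m * (\<Sum>k<n. renewal x (n - 1 - k) * (mat_vec H ^^ Suc k) one_vec i))"
    using Suc.IH by (simp add: fun_eq_iff mult_ac)
  have "mat_vec H ((mean_op H g m ^^ n) x) i = dot (H i) ((mat_vec H ^^ n) x) +
      dot (H i) (\<lambda>i. m * (\<Sum>k<n. renewal x (n - 1 - k) * (mat_vec H ^^ Suc k) one_vec i))"
    unfolding IH
    by (subst mat_vec_eq_dot, intro dot_add H_row bounded_mat_vec_pow x bounded_scale_range bounded_sum_range b)
  also have "dot (H i) (\<lambda>i. m * (\<Sum>k<n. renewal x (n - 1 - k) * (mat_vec H ^^ Suc k) one_vec i)) =
      m * (\<Sum>k<n. renewal x (n - 1 - k) * dot (H i) ((mat_vec H ^^ Suc k) one_vec))"
    by (subst dot_scale, rule H_row, intro bounded_sum_range bounded_scale_range b,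
        subst dot_sum, rule H_row, rule b, rule refl)
  also have "\<dots> = m * (\<Sum>k<n. (mat_vec H ^^ Suc (Suc k)) one_vec i * renewal x (n - 1 - k))"
    by (simp add: mat_vec_eq_dot mult_ac)
  also have "dot (H i) ((mat_vec H ^^ n) x) = (mat_vec H ^^ Suc n) x i"
    by (simp add: mat_vec_eq_dot)
  finally have 1: "mat_vec H ((mean_op H g m ^^ n) x) i = (mat_vec H ^^ Suc n) x i +
      m * (\<Sum>k<n. (mat_vec H ^^ Suc (Suc k)) one_vec i * renewal x (n - 1 - k))" .
  have "(mean_op H g m ^^ Suc n) x i = mat_vec H ((mean_op H g m ^^ n) x) i +
      m * renewal x n * mat_vec H one_vec i"
    by (simp add: mean_op_def renewal_def)
  also have "\<dots> = (mat_vec H ^^ Suc n) x i +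
      m * (mat_vec H one_vec i * renewal x n +
        (\<Sum>k<n. (mat_vec H ^^ Suc (Suc k)) one_vec i * renewal x (n - 1 - k)))"
    unfolding 1 by (simp add: algebra_simps)
  also have "mat_vec H one_vec i * renewal x n +
        (\<Sum>k<n. (mat_vec H ^^ Suc (Suc k)) one_vec i * renewal x (n - 1 - k)) =
      (\<Sum>k<Suc n. (mat_vec H ^^ Suc k) one_vec i * renewal x (Suc n - 1 - k))"
    by (subst sum.lessThan_Suc_shift) simp
  finally show ?case .
qed simp

text \<open>Applying \<open>g\<close> to the expansion closes it into a scalar equation, because g
  H^(k+1) 1 is d with index k + 1.\<close>

lemma renewal_equation:
  assumes x: "bounded (range x)"
  shows "renewal x n = dot g ((mat_vec H ^^ n) x) +
    m * (\<Sum>k<n. lf_d H g (Suc k) * renewal x (n - 1 - k))"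
proof -
  have b: "bounded (range ((mat_vec H ^^ k) one_vec))" for k
    by (intro bounded_mat_vec_pow bounded_one_vec)
  have IH: "(mean_op H g m ^^ n) x = (\<lambda>i. (mat_vec H ^^ n) x i +
      m * (\<Sum>k<n. renewal x (n - 1 - k) * (mat_vec H ^^ Suc k) one_vec i))"
    using mean_op_pow_expansion[OF x, of n] by (simp add: fun_eq_iff mult_ac)
  have "renewal x n = dot g ((mat_vec H ^^ n) x) +
      dot g (\<lambda>i. m * (\<Sum>k<n. renewal x (n - 1 - k) * (mat_vec H ^^ Suc k) one_vec i))"
    unfolding renewal_def IH
    by (intro dot_add g_subprob bounded_mat_vec_pow x bounded_scale_range bounded_sum_range b)
  also have "dot g (\<lambda>i. m * (\<Sum>k<n. renewal x (n - 1 - k) * (mat_vec H ^^ Suc k) one_vec i)) =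
      m * (\<Sum>k<n. renewal x (n - 1 - k) * dot g ((mat_vec H ^^ Suc k) one_vec))"
    by (subst dot_scale, rule g_subprob, intro bounded_sum_range bounded_scale_range b,
        subst dot_sum, rule g_subprob, rule b, rule refl)
  finally show ?thesis by (simp add: lf_d_eq mult_ac del: funpow.simps)
qed

end

section \<open>Asymptotics in the supercritical case\<close>

lemma exp_minus_bounds:
  fixes y :: real
  assumes "0 \<le> y"
  shows "1 - y \<le> exp (- y)" "exp (- y) \<le> 1 - y + y\<^sup>2"
proof -
  show "1 - y \<le> exp (- y)" using exp_ge_add_one_self[of "- y"] by simp
  have "exp (- y) \<le> 1 / (1 + y)"
    using exp_ge_add_one_self[of y] assms by (simp add: exp_minus divide_simps)
  also have "\<dots> \<le> 1 - y + y\<^sup>2"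
    using assms by (simp add: divide_simps power2_eq_square algebra_simps)
  finally show "exp (- y) \<le> 1 - y + y\<^sup>2" .
qed

text \<open>\<open>R\<close> is an abstract root of the Malthusian equation here; that
  \<open>lf_R\<close> is such a root is shown separately. \<open>R < 1\<close> expresses rho >
  1.\<close>

locale lf_supercritical = lf_parameters +
  fixes R :: real
  assumes R_pos: "0 < R" and R_less_1: "R < 1"
    and malthus: "(\<lambda>n. m * lf_d H g (Suc n) * R ^ Suc n) sums 1"
begin

definition beta :: real where
  "beta = (\<Sum>n. real (Suc n) * (m * lf_d H g (Suc n) * R ^ Suc n))"

text \<open>The limit of R^n g M^n x. Up to the factor (1 + m) / (m beta) it is the pairing of v
  with \<open>x\<close>, so that c_w equals \<open>m * amplitude w\<close>.\<close>

definition amplitude :: "(nat \<Rightarrow> real) \<Rightarrow> real" where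
  "amplitude x = (\<Sum>n. R ^ n * dot g ((mat_vec H ^^ n) x)) / beta"

text \<open>The vector u without its normalising factor (1 + m) / beta.\<close>

definition right_vec :: "nat \<Rightarrow> real" where
  "right_vec i = (\<Sum>k. R ^ Suc k * (mat_vec H ^^ Suc k) one_vec i)"

lemma lf_d_1_pos: "0 < lf_d H g 1"
proof (rule ccontr)
  assume "\<not> 0 < lf_d H g 1"
  hence "lf_d H g (Suc n) \<le> 0" for n
    by (induction n) (use lf_d_antimono in \<open>auto intro: order_trans\<close>)
  hence "lf_d H g (Suc n) = 0" for n using lf_d_unit_interval(1)[of "Suc n"] by (simp add: order_antisym)
  thus False using malthus by (auto simp: sums_iff)
qed

lemma summable_beta: "summable (\<lambda>n. real (Suc n) * (m * lf_d H g (Suc n) * R ^ Suc n))"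
proof (rule summable_comparison_test'[where N = 0])
  show "summable (\<lambda>n. m * R * (real (Suc n) * R ^ n))"
    using geometric_deriv_sums[of R] R_pos R_less_1 by (intro summable_mult) (auto simp: sums_iff)
  fix n
  have "m * lf_d H g (Suc n) \<le> m" using lf_d_unit_interval[of "Suc n"] m_pos by simp
  hence "real (Suc n) * (m * lf_d H g (Suc n) * R ^ Suc n) \<le> real (Suc n) * (m * R ^ Suc n)"
    using R_pos by (intro mult_left_mono mult_right_mono) auto
  thus "norm (real (Suc n) * (m * lf_d H g (Suc n) * R ^ Suc n)) \<le> m * R * (real (Suc n) * R ^ n)"
    using lf_d_unit_interval[of "Suc n"] m_pos R_pos by (simp add: mult_ac)
qed

lemma beta_pos: "0 < beta"
  unfolding beta_def
proof (rule suminf_pos2[OF summable_beta])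
  show "0 \<le> real (Suc n) * (m * lf_d H g (Suc n) * R ^ Suc n)" for n
    using lf_d_unit_interval[of "Suc n"] m_pos R_pos by simp
  show "0 < real (Suc 0) * (m * lf_d H g (Suc 0) * R ^ Suc 0)"
    using lf_d_1_pos m_pos R_pos by simp
qed

text \<open>Multiplied by R^n, the renewal equation has weights of total mass 1 by
  \<open>malthus\<close>. The weights are at most m R^n and the inhomogeneity at most C R^n, so both
  tails are geometric with ratio \<open>R\<close>.\<close>

lemma renewal_limit:
  assumes x: "bounded (range x)"
  shows "(\<lambda>n. R ^ n * renewal x n) \<longlonglongrightarrow> amplitude x"
proof -
  obtain C where C: "C \<ge> 0" "\<And>i. \<bar>x i\<bar> \<le> C" using bounded_rangeE[OF x] by blast
  \<comment> \<open>The equation for \<open>renewal\<close> starts with the weight d_1; setting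
    \<open>p 0 = 0\<close> absorbs the resulting shift by one.\<close>
  define p where "p n = (if n = 0 then 0 else m * lf_d H g n * R ^ n)" for n
  have "(\<lambda>n. R ^ n * renewal x n) \<longlonglongrightarrow>
      (\<Sum>n. R ^ n * dot g ((mat_vec H ^^ n) x)) / (\<Sum>n. real (Suc n) * p (Suc n))"
  proof (rule renewal_theorem_geometric[where p = p and r = R and K = m and L = C])
    show "p 1 > 0" using lf_d_1_pos m_pos R_pos by (simp add: p_def)
    show "p n \<ge> 0" for n using lf_d_unit_interval[of n] m_pos R_pos by (simp add: p_def)
    show "p sums 1"
      using malthus sums_Suc_iff[of p 1] by (simp add: p_def)
    show "p n \<le> m * R ^ n" for n
      using lf_d_unit_interval[of n] m_pos R_pos by (auto simp: p_def intro!: mult_right_mono)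
    show "\<bar>R ^ n * dot g ((mat_vec H ^^ n) x)\<bar> \<le> C * R ^ n" for n
      using abs_dot_le[OF g_subprob, of "(mat_vec H ^^ n) x" C] abs_mat_vec_pow_le[of x C n] C R_pos
      by (auto simp: abs_mult mult.commute intro!: mult_right_mono)
    fix n
    have "(\<Sum>k\<le>n. p k * (R ^ (n - k) * renewal x (n - k))) =
        (\<Sum>k<n. p (Suc k) * (R ^ (n - Suc k) * renewal x (n - Suc k)))"
      by (subst sum.atMost_shift) (simp add: p_def)
    also have "\<dots> = (\<Sum>k<n. R ^ n * (m * (lf_d H g (Suc k) * renewal x (n - 1 - k))))"
    proof (rule sum.cong)
      fix k assume "k \<in> {..<n}"
      hence "R ^ n = R ^ Suc k * R ^ (n - Suc k)" by (subst power_add[symmetric]) auto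
      thus "p (Suc k) * (R ^ (n - Suc k) * renewal x (n - Suc k)) =
          R ^ n * (m * (lf_d H g (Suc k) * renewal x (n - 1 - k)))"
        by (simp add: p_def)
    qed simp
    finally show "R ^ n * renewal x n = R ^ n * dot g ((mat_vec H ^^ n) x) +
        (\<Sum>k\<le>n. p k * (R ^ (n - k) * renewal x (n - k)))"
      by (subst renewal_equation[OF x]) (simp add: distrib_left sum_distrib_left)
  qed (use R_pos R_less_1 in \<open>auto simp: p_def\<close>)
  thus ?thesis by (simp add: amplitude_def beta_def p_def)
qed

text \<open>Inherited from \<open>renewal\<close> by uniqueness of limits, without touching the
  defining series.\<close>

lemma amplitude_lincomb:
  assumes "bounded (range x)" "bounded (range y)"
  shows "amplitude (\<lambda>i. a * x i + b * y i) = a * amplitude x + b * amplitude y"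
proof (rule LIMSEQ_unique)
  show "(\<lambda>n. R ^ n * renewal (\<lambda>i. a * x i + b * y i) n) \<longlonglongrightarrow> amplitude (\<lambda>i. a * x i + b * y i)"
    using assms by (intro renewal_limit bounded_add_range bounded_scale_range)
  have "(\<lambda>n. a * (R ^ n * renewal x n) + b * (R ^ n * renewal y n)) \<longlonglongrightarrow> a * amplitude x + b * amplitude y"
    using assms by (intro tendsto_intros renewal_limit)
  thus "(\<lambda>n. R ^ n * renewal (\<lambda>i. a * x i + b * y i) n) \<longlonglongrightarrow> a * amplitude x + b * amplitude y"
    by (simp add: renewal_lincomb[OF assms] algebra_simps)
qed

lemma amplitude_one_pos: "0 < amplitude one_vec"
proof -
  have "summable (\<lambda>n. R ^ n * lf_d H g n)"
  proof (rule summable_comparison_test'[where N = 0])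
    show "summable (\<lambda>n. R ^ n)" using R_pos R_less_1 by simp
    show "norm (R ^ n * lf_d H g n) \<le> R ^ n" for n
      using lf_d_unit_interval[of n] R_pos by (simp add: mult_left_le)
  qed
  moreover have "0 < R ^ 1 * lf_d H g 1" using R_pos lf_d_1_pos by simp
  ultimately have "0 < (\<Sum>n. R ^ n * lf_d H g n)"
    using lf_d_unit_interval R_pos by (intro suminf_pos2[of _ 1]) auto
  thus ?thesis using beta_pos by (simp add: amplitude_def lf_d_eq)
qed

lemma amplitude_nonneg: "bounded (range x) \<Longrightarrow> (\<And>i. 0 \<le> x i) \<Longrightarrow> 0 \<le> amplitude x"
  using renewal_nonneg[of x] R_pos
  by (intro LIMSEQ_le_const[OF renewal_limit]) auto

lemma summable_right_vec: "summable (\<lambda>k. \<bar>R ^ Suc k * (mat_vec H ^^ Suc k) one_vec i\<bar>)"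
proof (rule summable_comparison_test'[where N = 0])
  show "summable (\<lambda>k. R * R ^ k)" using R_pos R_less_1 by (intro summable_mult) simp
  show "norm \<bar>R ^ Suc k * (mat_vec H ^^ Suc k) one_vec i\<bar> \<le> R * R ^ k" for k
    using mat_vec_pow_one_unit_interval[of "Suc k" i] R_pos
    by (simp add: abs_mult mult_left_le del: funpow.simps)
qed

text \<open>In the expansion of M^n x, scaled by R^n, the term with H^n vanishes. The rest is the
  convolution of the summable sequence R^k H^k 1 with the convergent sequence R^n g M^n x.\<close>

lemma mean_limit:
  assumes x: "bounded (range x)"
  shows "(\<lambda>n. R ^ n * (mean_op H g m ^^ n) x i) \<longlonglongrightarrow> m * amplitude x * right_vec i"
proof -
  obtain C where C: "C \<ge> 0" "\<And>i. \<bar>x i\<bar> \<le> C" using bounded_rangeE[OF x] by blast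
  \<comment> \<open>The index n + 1 is used so that the sum over k < n + 1 becomes one over k \<le>
    n, the form of \<open>convolution_tendsto\<close>.\<close>
  have "(\<lambda>n. R ^ Suc n * (mat_vec H ^^ Suc n) x i) \<longlonglongrightarrow> 0"
  proof (rule Lim_null_comparison)
    show "eventually (\<lambda>n. norm (R ^ Suc n * (mat_vec H ^^ Suc n) x i) \<le> R ^ Suc n * C) sequentially"
      using abs_mat_vec_pow_le[of x C "Suc _" i] C R_pos
      by (intro always_eventually) (auto simp: abs_mult simp del: funpow.simps power_Suc intro!: mult_left_mono)
    have "(\<lambda>n. R ^ n) \<longlonglongrightarrow> 0" using R_pos R_less_1 by (intro LIMSEQ_power_zero) auto
    hence "(\<lambda>n. R ^ Suc n * C) \<longlonglongrightarrow> 0 * C" by (intro tendsto_mult tendsto_const LIMSEQ_Suc)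
    thus "(\<lambda>n. R ^ Suc n * C) \<longlonglongrightarrow> 0" by simp
  qed
  moreover have "(\<lambda>n. \<Sum>k\<le>n. R ^ Suc k * (mat_vec H ^^ Suc k) one_vec i * (R ^ (n - k) * renewal x (n - k)))
      \<longlonglongrightarrow> right_vec i * amplitude x"
    unfolding right_vec_def by (rule convolution_tendsto[OF summable_right_vec renewal_limit[OF x]])
  ultimately have "(\<lambda>n. R ^ Suc n * (mat_vec H ^^ Suc n) x i + m *
      (\<Sum>k\<le>n. R ^ Suc k * (mat_vec H ^^ Suc k) one_vec i * (R ^ (n - k) * renewal x (n - k))))
      \<longlonglongrightarrow> 0 + m * (right_vec i * amplitude x)"
    by (intro tendsto_intros)
  moreover have "R ^ Suc n * (mean_op H g m ^^ Suc n) x i = R ^ Suc n * (mat_vec H ^^ Suc n) x i + m *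
      (\<Sum>k\<le>n. R ^ Suc k * (mat_vec H ^^ Suc k) one_vec i * (R ^ (n - k) * renewal x (n - k)))" for n
  proof -
    have "(\<Sum>k\<le>n. R ^ Suc k * (mat_vec H ^^ Suc k) one_vec i * (R ^ (n - k) * renewal x (n - k))) =
        (\<Sum>k\<le>n. R ^ Suc n * ((mat_vec H ^^ Suc k) one_vec i * renewal x (n - k)))"
    proof (rule sum.cong)
      fix k assume "k \<in> {..n}"
      hence "R ^ Suc n = R ^ Suc k * R ^ (n - k)" by (subst power_add[symmetric]) auto
      thus "R ^ Suc k * (mat_vec H ^^ Suc k) one_vec i * (R ^ (n - k) * renewal x (n - k)) =
          R ^ Suc n * ((mat_vec H ^^ Suc k) one_vec i * renewal x (n - k))"
        by (simp only: mult_ac)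
    qed simp
    thus ?thesis
      unfolding mean_op_pow_expansion[OF x, of "Suc n"] lessThan_Suc_atMost
      by (simp only: distrib_left sum_distrib_left diff_Suc_1 mult_ac)
  qed
  ultimately have "(\<lambda>n. R ^ Suc n * (mean_op H g m ^^ Suc n) x i) \<longlonglongrightarrow> m * amplitude x * right_vec i"
    by (simp only: add_0 mult_ac)
  thus ?thesis by (rule LIMSEQ_imp_Suc)
qed

text \<open>The scaled partial sum is itself a convolution, namely of the geometric weights R^(k+1),
  of total mass R / (1 - R), with the convergent sequence R^n g M^n x.\<close>

lemma renewal_sum_limit:
  assumes x: "bounded (range x)"
  shows "(\<lambda>n. R ^ n * (\<Sum>k<n. renewal x k)) \<longlonglongrightarrow> amplitude x * R / (1 - R)"
proof -
  have s: "(\<lambda>k. R ^ Suc k) sums (R * (1 / (1 - R)))"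
    using R_pos R_less_1 geometric_sums[of R] by (auto dest: sums_mult[of _ _ R])
  have "summable (\<lambda>k. \<bar>R ^ Suc k\<bar>)" using s R_pos by (simp add: sums_iff abs_mult)
  from convolution_tendsto[OF this renewal_limit[OF x]]
  have "(\<lambda>n. \<Sum>k\<le>n. R ^ Suc k * (R ^ (n - k) * renewal x (n - k))) \<longlonglongrightarrow> amplitude x * R / (1 - R)"
    using s by (simp add: sums_iff mult_ac)
  moreover have "(\<Sum>k\<le>n. R ^ Suc k * (R ^ (n - k) * renewal x (n - k))) =
      R ^ Suc n * (\<Sum>k<Suc n. renewal x k)" for n
  proof -
    have "(\<Sum>k\<le>n. R ^ Suc k * (R ^ (n - k) * renewal x (n - k))) =
        (\<Sum>k<Suc n. R ^ Suc n * renewal x (Suc n - Suc k))"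
    proof (rule sum.cong)
      fix k assume "k \<in> {..<Suc n}"
      hence "R ^ Suc n = R ^ Suc k * R ^ (n - k)" by (subst power_add[symmetric]) auto
      thus "R ^ Suc k * (R ^ (n - k) * renewal x (n - k)) = R ^ Suc n * renewal x (Suc n - Suc k)"
        by (simp only: mult_ac diff_Suc_Suc)
    qed auto
    also have "\<dots> = R ^ Suc n * (\<Sum>k<Suc n. renewal x k)"
      by (simp only: sum_distrib_left[symmetric] sum.nat_diff_reindex)
    finally show ?thesis .
  qed
  ultimately have "(\<lambda>n. R ^ Suc n * (\<Sum>k<Suc n. renewal x k)) \<longlonglongrightarrow> amplitude x * R / (1 - R)"
    by (simp only:)
  thus ?thesis by (rule LIMSEQ_imp_Suc)
qed

text \<open>Positivity of \<open>M\<close>, applied to \<open>e\<close> and to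
  \<open>c * one_vec - e\<close>. It serves to show that linearisation errors are
  negligible.\<close>

lemma mean_op_pow_abs_le:
  assumes e: "\<And>j. 0 \<le> e j" "\<And>j. e j \<le> c"
  shows "0 \<le> (mean_op H g m ^^ n) e i" "(mean_op H g m ^^ n) e i \<le> c * (mean_op H g m ^^ n) one_vec i"
    "0 \<le> renewal e n" "renewal e n \<le> c * renewal one_vec n"
proof -
  have b: "bounded (range e)" by (rule bounded_rangeI[where C = c]) (use e in auto)
  note b1 = bounded_one_vec
  have nn: "0 \<le> c * one_vec j + - 1 * e j" for j using e(2)[of j] by (simp add: one_vec_def)
  have bd: "bounded (range (\<lambda>j. c * one_vec j + - 1 * e j))"
    by (intro bounded_add_range bounded_scale_range b b1)
  show "0 \<le> (mean_op H g m ^^ n) e i" using mean_op_pow_nonneg[OF b] e by auto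
  show "0 \<le> renewal e n" using renewal_nonneg[OF b] e by auto
  show "(mean_op H g m ^^ n) e i \<le> c * (mean_op H g m ^^ n) one_vec i"
    using mean_op_pow_nonneg[OF bd nn, of n i] unfolding mean_op_pow_lincomb[OF b1 b] by simp
  show "renewal e n \<le> c * renewal one_vec n"
    using renewal_nonneg[OF bd nn, of n] unfolding renewal_lincomb[OF b1 b] by simp
qed

text \<open>The Laplace transform is the generating function at 1 - x with x = 1 - exp (- R^n b),
  and x differs from R^n b by at most C^2 R^(2n). Both M^n and the sum in the denominator grow like
  R^(-n), so this error contributes only order R^n and x may be replaced by R^n b.\<close>

lemma expectation_exp_limit:
  assumes LF: "\<And>i. has_LF (off i) (H i) g m" and b: "bounded (range b)" "\<And>j. 0 \<le> b j"
  shows "(\<lambda>n. measure_pmf.expectation (generation off n {#i#}) (\<lambda>z. exp (- (R ^ n * (\<Sum>j\<in>#z. b j)))))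
    \<longlonglongrightarrow> 1 - m * amplitude b * right_vec i / (1 + m * (amplitude b * R / (1 - R)))"
proof -
  obtain C where C: "C \<ge> 0" "\<And>i. \<bar>b i\<bar> \<le> C" using bounded_rangeE[OF b(1)] by blast
  define x where "x n j = 1 - exp (- (R ^ n * b j))" for n j
  define e where "e n j = R ^ n * b j - x n j" for n j
  have bx: "0 \<le> x n j" "x n j \<le> 1" for n j using b R_pos by (auto simp: x_def)
  have e: "0 \<le> e n j" "e n j \<le> C\<^sup>2 * R ^ n * R ^ n" for n j
  proof -
    have y: "0 \<le> R ^ n * b j" using b R_pos by simp
    show "0 \<le> e n j" using exp_minus_bounds(1)[OF y] by (simp add: e_def x_def)
    have "e n j \<le> (R ^ n * b j)\<^sup>2" using exp_minus_bounds(2)[OF y] by (simp add: e_def x_def)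
    also have "\<dots> \<le> (R ^ n * C)\<^sup>2"
      using C(2)[of j] b R_pos y by (intro power_mono mult_left_mono) auto
    finally show "e n j \<le> C\<^sup>2 * R ^ n * R ^ n" by (simp add: power2_eq_square mult_ac)
  qed
  have be: "bounded (range (e n))" for n
    by (rule bounded_rangeI[where C = "C\<^sup>2 * R ^ n * R ^ n"]) (use e in auto)
  note E = mean_op_pow_abs_le[of "e n" "C\<^sup>2 * R ^ n * R ^ n" for n, OF e]
  have x_eq: "x n = (\<lambda>j. R ^ n * b j + - 1 * e n j)" for n by (simp add: e_def fun_eq_iff)
  have prod: "(\<Prod>j\<in>#z. 1 - x n j) = exp (- (R ^ n * (\<Sum>j\<in>#z. b j)))" for n z
    by (induction z) (simp_all add: x_def distrib_left exp_add exp_diff exp_minus divide_inverse)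
  have R0: "(\<lambda>n. R ^ n) \<longlonglongrightarrow> 0" using R_pos R_less_1 by (intro LIMSEQ_power_zero) auto
  have num: "(\<lambda>n. (mean_op H g m ^^ n) (x n) i) \<longlonglongrightarrow> m * amplitude b * right_vec i"
  proof -
    have "(\<lambda>n. (mean_op H g m ^^ n) (e n) i) \<longlonglongrightarrow> 0"
    proof (rule tendsto_sandwich[where f = "\<lambda>_. 0"])
      have "(\<lambda>n. C\<^sup>2 * R ^ n * (R ^ n * (mean_op H g m ^^ n) one_vec i)) \<longlonglongrightarrow>
          C\<^sup>2 * 0 * (m * amplitude one_vec * right_vec i)"
        by (intro tendsto_intros R0 mean_limit bounded_one_vec)
      thus "(\<lambda>n. C\<^sup>2 * R ^ n * R ^ n * (mean_op H g m ^^ n) one_vec i) \<longlonglongrightarrow> 0"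
        by (simp add: mult_ac)
      show "eventually (\<lambda>n. 0 \<le> (mean_op H g m ^^ n) (e n) i) sequentially"
        using E(1) by (intro always_eventually allI)
      show "eventually (\<lambda>n. (mean_op H g m ^^ n) (e n) i \<le>
          C\<^sup>2 * R ^ n * R ^ n * (mean_op H g m ^^ n) one_vec i) sequentially"
        using E(2) by (intro always_eventually allI)
    qed simp
    hence "(\<lambda>n. R ^ n * (mean_op H g m ^^ n) b i + - 1 * (mean_op H g m ^^ n) (e n) i) \<longlonglongrightarrow>
        m * amplitude b * right_vec i + - 1 * 0"
      by (intro tendsto_add tendsto_mult[OF tendsto_const] mean_limit b)
    thus ?thesis unfolding x_eq mean_op_pow_lincomb[OF b(1) be] by simp
  qed
  have den: "(\<lambda>n. \<Sum>k<n. renewal (x n) k) \<longlonglongrightarrow> amplitude b * R / (1 - R)"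
  proof -
    have "(\<lambda>n. \<Sum>k<n. renewal (e n) k) \<longlonglongrightarrow> 0"
    proof (rule tendsto_sandwich[where f = "\<lambda>_. 0"])
      have "(\<lambda>n. C\<^sup>2 * R ^ n * (R ^ n * (\<Sum>k<n. renewal one_vec k))) \<longlonglongrightarrow>
          C\<^sup>2 * 0 * (amplitude one_vec * R / (1 - R))"
        by (intro tendsto_mult tendsto_const R0 renewal_sum_limit bounded_one_vec)
      thus "(\<lambda>n. \<Sum>k<n. C\<^sup>2 * R ^ n * R ^ n * renewal one_vec k) \<longlonglongrightarrow> 0"
        by (simp add: sum_distrib_left mult_ac)
      show "eventually (\<lambda>n. (\<Sum>k<n. renewal (e n) k) \<le>
          (\<Sum>k<n. C\<^sup>2 * R ^ n * R ^ n * renewal one_vec k)) sequentially"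
        using E(4) by (intro always_eventually allI sum_mono) auto
      show "eventually (\<lambda>n. 0 \<le> (\<Sum>k<n. renewal (e n) k)) sequentially"
        using E(3) by (intro always_eventually allI sum_nonneg) auto
    qed simp
    hence "(\<lambda>n. R ^ n * (\<Sum>k<n. renewal b k) + - 1 * (\<Sum>k<n. renewal (e n) k)) \<longlonglongrightarrow>
        amplitude b * R / (1 - R) + - 1 * 0"
      by (intro tendsto_add tendsto_mult[OF tendsto_const] renewal_sum_limit b)
    thus ?thesis unfolding x_eq renewal_lincomb[OF b(1) be]
      by (simp add: sum.distrib sum_distrib_left sum_negf sum_subtractf)
  qed
  have "0 \<le> m * (amplitude b * R / (1 - R))"
    using amplitude_nonneg[OF b] m_pos R_pos R_less_1 by simp
  hence "1 + m * (amplitude b * R / (1 - R)) \<noteq> 0" by linarith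
  hence "(\<lambda>n. 1 - (mean_op H g m ^^ n) (x n) i / (1 + m * (\<Sum>k<n. renewal (x n) k))) \<longlonglongrightarrow>
      1 - m * amplitude b * right_vec i / (1 + m * (amplitude b * R / (1 - R)))"
    by (intro tendsto_intros num den)
  moreover have "measure_pmf.expectation (generation off n {#i#}) (\<lambda>z. exp (- (R ^ n * (\<Sum>j\<in>#z. b j)))) =
      1 - (mean_op H g m ^^ n) (x n) i / (1 + m * (\<Sum>k<n. renewal (x n) k))" for n
    using expectation_generation_LF[OF LF, where x = "x n"] bx by (simp add: prod)
  ultimately show ?thesis by simp
qed

end

section \<open>Comparing random variables in probability, and exponential limits of geometric
  laws\<close>

lemma slutsky_tail:
  fixes q :: "nat \<Rightarrow> 'a pmf" and V T :: "nat \<Rightarrow> 'a \<Rightarrow> real"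
  assumes tail: "\<And>y. y > 0 \<Longrightarrow> (\<lambda>n. measure (q n) {z. T n z > y}) \<longlonglongrightarrow> F y"
    and cont: "isCont F x"
    and close: "\<And>e. e > 0 \<Longrightarrow> (\<lambda>n. measure (q n) {z. \<bar>V n z - T n z\<bar> > e}) \<longlonglongrightarrow> 0"
    and x: "x > 0"
  shows "(\<lambda>n. measure (q n) {z. V n z > x}) \<longlonglongrightarrow> F x"
proof (rule tendstoI)
  fix e :: real assume e: "e > 0"
  obtain d' where d': "d' > 0" "\<And>y. dist y x < d' \<Longrightarrow> dist (F y) (F x) < e / 3"
    using cont e unfolding continuous_at_eps_delta by (metis divide_pos_pos zero_less_numeral)
  \<comment> \<open>Small enough for the continuity of \<open>F\<close> at \<open>x\<close>, and
    below \<open>x\<close> so that the tail limit applies at the positive point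
    \<open>x - d\<close>.\<close>
  define d where "d = min (d' / 2) (x / 2)"
  have d: "0 < d" "d < d'" "d < x" using d' x by (auto simp: d_def)
  have F: "\<bar>F (x + d) - F x\<bar> < e / 3" "\<bar>F (x - d) - F x\<bar> < e / 3"
    using d'(2)[of "x + d"] d'(2)[of "x - d"] d by (auto simp: dist_real_def)
  have 1: "eventually (\<lambda>n. dist (measure (q n) {z. T n z > x + d}) (F (x + d)) < e / 3) sequentially"
    using d x e by (intro tendstoD tail) auto
  have 2: "eventually (\<lambda>n. dist (measure (q n) {z. T n z > x - d}) (F (x - d)) < e / 3) sequentially"
    using d x e by (intro tendstoD tail) auto
  have 3: "eventually (\<lambda>n. dist (measure (q n) {z. \<bar>V n z - T n z\<bar> > d}) 0 < e / 3) sequentially"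
    using d e by (intro tendstoD close) auto
  show "eventually (\<lambda>n. dist (measure (q n) {z. V n z > x}) (F x) < e) sequentially"
    using 1 2 3
  proof eventually_elim
    case (elim n)
    have "measure (q n) {z. V n z > x} \<le>
        measure (q n) ({z. T n z > x - d} \<union> {z. \<bar>V n z - T n z\<bar> > d})"
      by (intro measure_pmf.finite_measure_mono) auto
    also have "\<dots> \<le> measure (q n) {z. T n z > x - d} + measure (q n) {z. \<bar>V n z - T n z\<bar> > d}"
      by (intro measure_Un_le) auto
    finally have upper: "measure (q n) {z. V n z > x} \<le> \<dots>" .
    have "measure (q n) {z. T n z > x + d} \<le>
        measure (q n) ({z. V n z > x} \<union> {z. \<bar>V n z - T n z\<bar> > d})"
      by (intro measure_pmf.finite_measure_mono) auto
    also have "\<dots> \<le> measure (q n) {z. V n z > x} + measure (q n) {z. \<bar>V n z - T n z\<bar> > d}"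
      by (intro measure_Un_le) auto
    finally have lower: "measure (q n) {z. T n z > x + d} \<le> \<dots>" .
    show ?case using upper lower elim F unfolding dist_real_def abs_less_iff by linarith
  qed
qed

text \<open>Below \<open>l\<close> the slope of exp (- y) has modulus at least exp (- l). Closeness
  of exponentials therefore implies closeness of the arguments as long as these stay
  bounded.\<close>

lemma exp_minus_diff_ge:
  fixes y s l :: real
  assumes "y \<le> l" "s \<le> l"
  shows "\<bar>y - s\<bar> * exp (- l) \<le> \<bar>exp (- y) - exp (- s)\<bar>"
proof -
  have *: "(b - a) * exp (- l) \<le> exp (- a) - exp (- b)" if "a \<le> b" "b \<le> l" for a b :: real
  proof -
    have "(b - a) * exp (- l) \<le> (b - a) * exp (- b)" using that by (intro mult_left_mono) auto
    also have "\<dots> \<le> (exp (b - a) - 1) * exp (- b)"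
    proof (rule mult_right_mono)
      show "b - a \<le> exp (b - a) - 1" using exp_ge_add_one_self[of "b - a"] by linarith
    qed simp
    also have "\<dots> = exp (- a) - exp (- b)" by (simp add: left_diff_distrib flip: exp_add)
    finally show ?thesis .
  qed
  show ?thesis
    using *[of y s] *[of s y] assms by (cases "y \<le> s") (auto simp: abs_real_def)
qed

text \<open>The exponential flattens at infinity, so the event that \<open>T\<close> exceeds a large
  \<open>C\<close> is split off; its limiting probability \<open>F C\<close> is small. Elsewhere
  both arguments are at most \<open>K * C\<close>, and Markov's inequality for the squared
  difference applies.\<close>

lemma tendsto_in_prob_if_exp_tendsto:
  fixes q :: "nat \<Rightarrow> 'a pmf" and Y S T :: "nat \<Rightarrow> 'a \<Rightarrow> real"
  assumes lim: "(\<lambda>n. measure_pmf.expectation (q n) (\<lambda>z. (exp (- Y n z) - exp (- S n z))\<^sup>2)) \<longlonglongrightarrow> 0"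
    and nonneg: "\<And>n z. 0 \<le> Y n z" "\<And>n z. 0 \<le> S n z"
    and le: "\<And>n z. Y n z \<le> K * T n z" "\<And>n z. S n z \<le> K * T n z" and K: "K \<ge> 0"
    and tail: "\<And>y. y > 0 \<Longrightarrow> (\<lambda>n. measure (q n) {z. T n z > y}) \<longlonglongrightarrow> F y"
    and F: "(F \<longlongrightarrow> 0) at_top" and e: "e > 0"
  shows "(\<lambda>n. measure (q n) {z. \<bar>Y n z - S n z\<bar> > e}) \<longlonglongrightarrow> 0"
proof (rule tendstoI)
  fix \<delta> :: real assume \<delta>: "\<delta> > 0"
  have "eventually (\<lambda>y. F y < \<delta> / 3) at_top" using \<delta> by (intro order_tendstoD(2)[OF F]) auto
  then obtain C where C: "C > 0" "F C < \<delta> / 3"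
    using eventually_happens[OF eventually_conj[OF _ eventually_gt_at_top[of 0]], of _] by auto
  \<comment> \<open>The least squared difference of exponentials when the arguments differ by more
    than \<open>e\<close> and do not exceed \<open>K * C\<close>.\<close>
  define c where "c = (e * exp (- (K * C)))\<^sup>2"
  have c: "c > 0" using e by (simp add: c_def)
  have 1: "eventually (\<lambda>n. dist (measure (q n) {z. T n z > C}) (F C) < \<delta> / 3) sequentially"
    using C \<delta> by (intro tendstoD tail) auto
  have 2: "eventually (\<lambda>n. dist (measure_pmf.expectation (q n)
      (\<lambda>z. (exp (- Y n z) - exp (- S n z))\<^sup>2)) 0 < \<delta> / 3 * c) sequentially"
    using \<delta> c by (intro tendstoD[OF lim]) auto
  show "eventually (\<lambda>n. dist (measure (q n) {z. \<bar>Y n z - S n z\<bar> > e}) 0 < \<delta>) sequentially"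
    using 1 2
  proof eventually_elim
    case (elim n)
    let ?D = "\<lambda>z. (exp (- Y n z) - exp (- S n z))\<^sup>2"
    have "?D z \<le> 1" for z
    proof -
      have "exp (- Y n z) \<le> 1" "exp (- S n z) \<le> 1" "0 < exp (- Y n z)" "0 < exp (- S n z)"
        using nonneg[of n z] by auto
      hence "\<bar>exp (- Y n z) - exp (- S n z)\<bar> \<le> 1" unfolding abs_le_iff by linarith
      thus ?thesis by (simp add: abs_square_le_1)
    qed
    hence int: "integrable (measure_pmf (q n)) ?D"
      by (intro measure_pmf.integrable_const_bound[of _ 1]) auto
    have incl: "{z. \<bar>Y n z - S n z\<bar> > e} \<subseteq> {z. T n z > C} \<union> {z. c \<le> ?D z}"
    proof
      fix z assume z: "z \<in> {z. \<bar>Y n z - S n z\<bar> > e}"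
      have "c \<le> ?D z" if "T n z \<le> C"
      proof -
        have "K * T n z \<le> K * C" using that K by (rule mult_left_mono)
        hence "\<bar>Y n z - S n z\<bar> * exp (- (K * C)) \<le> \<bar>exp (- Y n z) - exp (- S n z)\<bar>"
          using le[of n z] by (intro exp_minus_diff_ge) auto
        moreover have "e * exp (- (K * C)) \<le> \<bar>Y n z - S n z\<bar> * exp (- (K * C))"
          using z by (intro mult_right_mono) auto
        ultimately have "e * exp (- (K * C)) \<le> \<bar>exp (- Y n z) - exp (- S n z)\<bar>"
          by (rule order_trans[rotated])
        hence "(e * exp (- (K * C)))\<^sup>2 \<le> \<bar>exp (- Y n z) - exp (- S n z)\<bar>\<^sup>2"
          using e by (intro power_mono) auto
        thus ?thesis by (simp add: c_def)
      qed
      thus "z \<in> {z. T n z > C} \<union> {z. c \<le> ?D z}" by (cases "T n z \<le> C") auto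
    qed
    have "measure (q n) {z. \<bar>Y n z - S n z\<bar> > e} \<le> measure (q n) ({z. T n z > C} \<union> {z. c \<le> ?D z})"
      using incl by (intro measure_pmf.finite_measure_mono) auto
    also have "\<dots> \<le> measure (q n) {z. T n z > C} + measure (q n) {z. c \<le> ?D z}"
      by (intro measure_Un_le) auto
    also have "measure (q n) {z. c \<le> ?D z} \<le> measure_pmf.expectation (q n) ?D / c"
      using integral_Markov_inequality_measure[OF int, of UNIV c] c by simp
    also have "measure_pmf.expectation (q n) ?D / c < \<delta> / 3"
      using elim(2) c by (auto simp: dist_real_def field_simps)
    finally have "measure (q n) {z. \<bar>Y n z - S n z\<bar> > e} < measure (q n) {z. T n z > C} + \<delta> / 3" by simp
    moreover have "measure (q n) {z. T n z > C} < 2 * \<delta> / 3"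
      using elim(1) C(2) unfolding dist_real_def abs_less_iff by linarith
    ultimately show ?case by (simp add: dist_real_def)
  qed
qed

text \<open>The power is exp (- k ln (1 + 1 / B)), where k is asymptotic to y / r. The logarithm
  lies between 1 / (1 + B) and 1 / B, and both bounds multiplied by k tend to y / \<theta>.\<close>

lemma geometric_tail_limit:
  fixes B r :: "nat \<Rightarrow> real"
  assumes B: "(\<lambda>n. r n * B n) \<longlonglongrightarrow> \<theta>" and \<theta>: "\<theta> > 0"
    and r: "r \<longlonglongrightarrow> 0" "\<And>n. r n > 0" and y: "y > 0"
  shows "(\<lambda>n. (B n / (1 + B n)) ^ nat \<lfloor>y / r n\<rfloor>) \<longlonglongrightarrow> exp (- (y / \<theta>))"
proof -
  define k where "k n = real (nat \<lfloor>y / r n\<rfloor>)" for n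
  have pos: "eventually (\<lambda>n. B n > 0) sequentially"
    using order_tendstoD(1)[OF B \<theta>] by eventually_elim (use r(2) in \<open>simp add: zero_less_mult_iff less_not_sym\<close>)
  have k: "(\<lambda>n. r n * k n) \<longlonglongrightarrow> y"
  proof (rule tendsto_sandwich)
    have "y - r n \<le> r n * k n \<and> r n * k n \<le> y" for n
    proof -
      have "0 < y / r n" using y r(2) by simp
      hence "y / r n - 1 \<le> k n" "k n \<le> y / r n" unfolding k_def by linarith+
      thus ?thesis using r(2)[of n] by (simp add: field_simps)
    qed
    thus "eventually (\<lambda>n. y - r n \<le> r n * k n) sequentially"
      "eventually (\<lambda>n. r n * k n \<le> y) sequentially" by auto
    show "(\<lambda>n. y - r n) \<longlonglongrightarrow> y" using tendsto_diff[OF tendsto_const r(1), of y] by simp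
  qed simp
  have "(\<lambda>n. k n * ln (1 + 1 / B n)) \<longlonglongrightarrow> y / \<theta>"
  proof (rule tendsto_sandwich)
    show "eventually (\<lambda>n. r n * k n / (r n + r n * B n) \<le> k n * ln (1 + 1 / B n)) sequentially"
      using pos
    proof eventually_elim
      case (elim n)
      have "1 / (1 + B n) \<le> ln (1 + 1 / B n)"
      proof -
        have "ln (1 - 1 / (1 + B n)) \<le> - (1 / (1 + B n))"
          using ln_le_minus_one[of "1 - 1 / (1 + B n)"] elim by (simp add: field_simps)
        moreover have "1 - 1 / (1 + B n) = inverse (1 + 1 / B n)" using elim by (simp add: field_simps)
        ultimately show ?thesis using elim by (simp add: ln_inverse add_pos_pos)
      qed
      hence "k n * (1 / (1 + B n)) \<le> k n * ln (1 + 1 / B n)" by (intro mult_left_mono) (simp_all add: k_def)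
      moreover have "r n * k n / (r n + r n * B n) = k n * (1 / (1 + B n))"
        using r(2)[of n] by (simp flip: distrib_left[of "r n" 1, simplified])
      ultimately show ?case by simp
    qed
    show "eventually (\<lambda>n. k n * ln (1 + 1 / B n) \<le> r n * k n / (r n * B n)) sequentially"
      using pos
    proof eventually_elim
      case (elim n)
      have "k n * ln (1 + 1 / B n) \<le> k n * (1 / B n)"
        using elim by (intro mult_left_mono ln_add_one_self_le_self) (simp_all add: k_def)
      thus ?case using r(2)[of n] by simp
    qed
    show "(\<lambda>n. r n * k n / (r n * B n)) \<longlonglongrightarrow> y / \<theta>"
      using \<theta> by (intro tendsto_divide k B) auto
    have "(\<lambda>n. r n * k n / (r n + r n * B n)) \<longlonglongrightarrow> y / (0 + \<theta>)"
      using \<theta> by (intro tendsto_divide tendsto_add k B r) auto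
    thus "(\<lambda>n. r n * k n / (r n + r n * B n)) \<longlonglongrightarrow> y / \<theta>" by simp
  qed
  hence "(\<lambda>n. exp (- (k n * ln (1 + 1 / B n)))) \<longlonglongrightarrow> exp (- (y / \<theta>))"
    by (intro tendsto_intros)
  moreover have "eventually (\<lambda>n. exp (- (k n * ln (1 + 1 / B n))) = (B n / (1 + B n)) ^ nat \<lfloor>y / r n\<rfloor>) sequentially"
    using pos
  proof eventually_elim
    case (elim n)
    have "exp (- (k n * ln (1 + 1 / B n))) = exp (ln (inverse (1 + 1 / B n))) ^ nat \<lfloor>y / r n\<rfloor>"
      using elim by (simp add: ln_inverse add_pos_pos k_def flip: exp_of_nat_mult)
    also have "exp (ln (inverse (1 + 1 / B n))) = inverse (1 + 1 / B n)"
      using elim by (simp add: add_pos_pos)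
    also have "\<dots> = B n / (1 + B n)" using elim by (simp add: field_simps)
    finally show ?case .
  qed
  ultimately show ?thesis by (rule Lim_transform_eventually)
qed

section \<open>Survival probability, total population and bounded functionals\<close>

context lf_supercritical
begin

text \<open>Numerator and denominator of the exact formula are both scaled by R^n. Their limits are
  proportional to \<open>amplitude one_vec\<close>, which cancels and leaves (rho - 1) times
  \<open>right_vec\<close>.\<close>

lemma survival_limit:
  assumes LF: "\<And>i. has_LF (off i) (H i) g m"
  shows "(\<lambda>n. measure (generation off n {#i#}) {z. z \<noteq> {#}}) \<longlonglongrightarrow> (1 - R) / R * right_vec i"
proof -
  have S: "measure (generation off n {#i#}) {z. z \<noteq> {#}} =
      R ^ n * (mean_op H g m ^^ n) one_vec i / (R ^ n + m * (R ^ n * (\<Sum>k<n. renewal one_vec k)))" for n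
  proof -
    have "measure (generation off n {#i#}) {z. z \<noteq> {#}} =
        (mean_op H g m ^^ n) one_vec i / (1 + m * (\<Sum>k<n. renewal one_vec k))"
      using generation_size_tail[OF LF, of n i 0] by (simp add: Let_def nonempty_has_size)
    also have "\<dots> = (R ^ n * (mean_op H g m ^^ n) one_vec i) / (R ^ n * (1 + m * (\<Sum>k<n. renewal one_vec k)))"
      using R_pos by simp
    finally show ?thesis by (simp add: distrib_left mult_ac)
  qed
  have R0: "(\<lambda>n. R ^ n) \<longlonglongrightarrow> 0" using R_pos R_less_1 by (intro LIMSEQ_power_zero) auto
  have nz: "m * (amplitude one_vec * R / (1 - R)) > 0"
    using amplitude_one_pos m_pos R_pos R_less_1 by simp
  have "(\<lambda>n. measure (generation off n {#i#}) {z. z \<noteq> {#}}) \<longlonglongrightarrow>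
      m * amplitude one_vec * right_vec i / (0 + m * (amplitude one_vec * R / (1 - R)))"
    unfolding S using nz
    by (intro tendsto_divide tendsto_add tendsto_mult[OF tendsto_const] mean_limit renewal_sum_limit
        bounded_one_vec R0) auto
  moreover have "m * amplitude one_vec * right_vec i / (0 + m * (amplitude one_vec * R / (1 - R))) =
      (1 - R) / R * right_vec i"
    using amplitude_one_pos m_pos R_pos R_less_1 by (simp add: divide_simps)
  ultimately show ?thesis by simp
qed

text \<open>The exact tail is the survival probability times a power with exponent the integer part
  of y / R^n, so the two limits multiply.\<close>

lemma size_tail_limit:
  assumes LF: "\<And>i. has_LF (off i) (H i) g m" and y: "y > 0"
  shows "(\<lambda>n. measure (generation off n {#i#}) {z. R ^ n * real (size z) > y}) \<longlonglongrightarrow>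
    (1 - R) / R * right_vec i * exp (- (y / (m * (amplitude one_vec * R / (1 - R)))))"
proof -
  define B where "B n = m * (\<Sum>k<n. renewal one_vec k)" for n
  have R0: "(\<lambda>n. R ^ n) \<longlonglongrightarrow> 0" using R_pos R_less_1 by (intro LIMSEQ_power_zero) auto
  have nz: "m * (amplitude one_vec * R / (1 - R)) > 0"
    using amplitude_one_pos m_pos R_pos R_less_1 by simp
  have "(\<lambda>n. m * (R ^ n * (\<Sum>k<n. renewal one_vec k))) \<longlonglongrightarrow> m * (amplitude one_vec * R / (1 - R))"
    by (intro tendsto_mult[OF tendsto_const] renewal_sum_limit bounded_one_vec)
  hence "(\<lambda>n. R ^ n * B n) \<longlonglongrightarrow> m * (amplitude one_vec * R / (1 - R))"
    by (simp add: B_def mult_ac)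
  from geometric_tail_limit[OF this nz R0 _ y] R_pos
  have "(\<lambda>n. (B n / (1 + B n)) ^ nat \<lfloor>y / R ^ n\<rfloor>) \<longlonglongrightarrow>
      exp (- (y / (m * (amplitude one_vec * R / (1 - R)))))" by simp
  from tendsto_mult[OF survival_limit[OF LF] this]
  show ?thesis
  proof (rule filterlim_cong[THEN iffD1, rotated -1])
    show "eventually (\<lambda>n. measure (generation off n {#i#}) {z. z \<noteq> {#}} *
        (B n / (1 + B n)) ^ nat \<lfloor>y / R ^ n\<rfloor> =
        measure (generation off n {#i#}) {z. R ^ n * real (size z) > y}) sequentially"
    proof (intro always_eventually allI)
      fix n
      have "0 < y / R ^ n" using y R_pos by simp
      hence "real k > y / R ^ n \<longleftrightarrow> k > nat \<lfloor>y / R ^ n\<rfloor>" for k by linarith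
      hence "{z. R ^ n * real (size z) > y} = {z :: nat multiset. size z > nat \<lfloor>y / R ^ n\<rfloor>}"
        using R_pos by (auto simp: field_simps)
      thus "measure (generation off n {#i#}) {z. z \<noteq> {#}} * (B n / (1 + B n)) ^ nat \<lfloor>y / R ^ n\<rfloor> =
          measure (generation off n {#i#}) {z. R ^ n * real (size z) > y}"
        using generation_size_tail[OF LF, of n i 0] generation_size_tail[OF LF, of n i "nat \<lfloor>y / R ^ n\<rfloor>"]
        by (simp add: Let_def nonempty_has_size B_def)
    qed
  qed simp_all
qed

text \<open>The square expands into three Laplace transforms with the same limit, because the amplitude
  is linear and takes the same value at \<open>2 b\<close>, \<open>b + \<kappa> 1\<close> and \<open>2 \<kappa> 1\<close>.\<close>
lemma exp_difference_limit:
  assumes LF: "\<And>i. has_LF (off i) (H i) g m" and b: "bounded (range b)" "\<And>j. 0 \<le> b j"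
  defines "\<kappa> \<equiv> amplitude b / amplitude one_vec"
  shows "(\<lambda>n. measure_pmf.expectation (generation off n {#i#})
    (\<lambda>z. (exp (- (R ^ n * (\<Sum>j\<in>#z. b j))) - exp (- (\<kappa> * (R ^ n * real (size z)))))\<^sup>2)) \<longlonglongrightarrow> 0"
proof -
  have \<kappa>: "\<kappa> \<ge> 0" using amplitude_nonneg[OF b] amplitude_one_pos by (simp add: \<kappa>_def)
  have A: "\<kappa> * amplitude one_vec = amplitude b" using amplitude_one_pos by (simp add: \<kappa>_def)
  define c where "c s j = s * b j + (2 - s) * \<kappa> * one_vec j" for s j
  have c: "bounded (range (c s))" for s
    unfolding c_def by (intro bounded_add_range bounded_scale_range b bounded_one_vec)
  have c0: "0 \<le> c s j" if "0 \<le> s" "s \<le> 2" for s j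
    using that b \<kappa> by (simp add: c_def one_vec_def)
  have Ac: "amplitude (c s) = 2 * amplitude b" for s
  proof -
    have "amplitude (c s) = s * amplitude b + (2 - s) * \<kappa> * amplitude one_vec"
      unfolding c_def by (rule amplitude_lincomb[OF b(1) bounded_one_vec])
    also have "\<dots> = s * amplitude b + (2 - s) * amplitude b" by (simp only: mult.assoc A)
    finally show ?thesis by (simp add: algebra_simps)
  qed
  define L where "L = 1 - m * (2 * amplitude b) * right_vec i / (1 + m * (2 * amplitude b * R / (1 - R)))"
  define E where "E s n = measure_pmf.expectation (generation off n {#i#})
    (\<lambda>z. exp (- (R ^ n * (\<Sum>j\<in>#z. c s j))))" for s n
  have lim: "E s \<longlonglongrightarrow> L" if "0 \<le> s" "s \<le> 2" for s
    using expectation_exp_limit[OF LF c c0[OF that], of i] unfolding Ac L_def E_def[abs_def] .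
  have sum_c: "(\<Sum>j\<in>#z. c s j) = s * (\<Sum>j\<in>#z. b j) + (2 - s) * \<kappa> * real (size z)" for z s
    by (induction z) (simp_all add: c_def one_vec_def algebra_simps)
  have int: "integrable (measure_pmf p) (\<lambda>z. exp (- (R ^ n * (\<Sum>j\<in>#z. c s j))))"
    if "0 \<le> s" "s \<le> 2" for s n p
  proof (rule measure_pmf.integrable_const_bound[of _ 1])
    have "0 \<le> (\<Sum>j\<in>#z. c s j)" for z using c0[OF that] by (induction z) auto
    thus "AE z in measure_pmf p. norm (exp (- (R ^ n * (\<Sum>j\<in>#z. c s j)))) \<le> 1"
      using R_pos by simp
  qed simp
  have "(\<lambda>n. E 2 n - 2 * E 1 n + E 0 n) \<longlonglongrightarrow> L - 2 * L + L"
    by (intro tendsto_intros lim) auto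
  moreover have "measure_pmf.expectation (generation off n {#i#})
      (\<lambda>z. (exp (- (R ^ n * (\<Sum>j\<in>#z. b j))) - exp (- (\<kappa> * (R ^ n * real (size z)))))\<^sup>2) =
      E 2 n - 2 * E 1 n + E 0 n" for n
  proof -
    have "(exp (- (R ^ n * (\<Sum>j\<in>#z. b j))) - exp (- (\<kappa> * (R ^ n * real (size z)))))\<^sup>2 =
        exp (- (R ^ n * (\<Sum>j\<in>#z. c 2 j))) - 2 * exp (- (R ^ n * (\<Sum>j\<in>#z. c 1 j))) +
        exp (- (R ^ n * (\<Sum>j\<in>#z. c 0 j)))" for z
      unfolding sum_c power2_diff by (simp add: power2_eq_square algebra_simps flip: exp_add)
    thus ?thesis using int by (simp add: E_def)
  qed
  ultimately show ?thesis by simp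
qed

text \<open>After the shift b = w + K 1, \<open>Z b\<close> is close in probability to \<kappa>
  times the population size, on the scale R^n. Subtracting K times the size from both sides leaves
  the difference unchanged and replaces \<kappa> by \<kappa>'. So \<open>Z w\<close> inherits the
  tail of \<kappa>' times the size.\<close>

lemma functional_tail_limit:
  assumes LF: "\<And>i. has_LF (off i) (H i) g m" and w: "bounded (range w)" and A: "amplitude w > 0"
    and x: "x > 0"
  shows "(\<lambda>n. measure (generation off n {#i#}) {z. R ^ n * (\<Sum>j\<in>#z. w j) > x}) \<longlonglongrightarrow>
    (1 - R) / R * right_vec i * exp (- (x * (1 - R) / (R * m * amplitude w)))"
proof -
  obtain K where K: "K \<ge> 0" "\<And>i. \<bar>w i\<bar> \<le> K" using bounded_rangeE[OF w] by blast
  define b where "b j = 1 * w j + K * one_vec j" for j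
  define \<kappa> where "\<kappa> = amplitude b / amplitude one_vec"
  define \<kappa>' where "\<kappa>' = amplitude w / amplitude one_vec"
  note A1 = amplitude_one_pos
  have b: "bounded (range b)" unfolding b_def
    by (intro bounded_add_range bounded_scale_range w bounded_one_vec)
  have b0: "0 \<le> b j" and b1: "b j \<le> 2 * K" for j
    using K(2)[of j] by (auto simp: b_def one_vec_def)
  have "amplitude b = amplitude w + K * amplitude one_vec"
    unfolding b_def amplitude_lincomb[OF w bounded_one_vec] by simp
  hence \<kappa>_eq: "\<kappa> = \<kappa>' + K" using A1 by (simp add: \<kappa>_def \<kappa>'_def field_simps)
  have \<kappa>': "\<kappa>' > 0" using A A1 by (simp add: \<kappa>'_def)
  define F where "F y = (1 - R) / R * right_vec i * exp (- (y / (m * (amplitude one_vec * R / (1 - R)))))" for y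
  have tail: "(\<lambda>n. measure (generation off n {#i#}) {z. R ^ n * real (size z) > y}) \<longlonglongrightarrow> F y"
    if "y > 0" for y
    unfolding F_def using LF that by (rule size_tail_limit)
  have F0: "(F \<longlongrightarrow> 0) at_top"
  proof -
    have exp0: "((\<lambda>y. exp (- (y / \<theta>))) \<longlongrightarrow> 0) at_top" if "\<theta> > 0" for \<theta> :: real
      using that by real_asymp
    have "m * (amplitude one_vec * R / (1 - R)) > 0" using A1 m_pos R_pos R_less_1 by simp
    from exp0[OF this] show ?thesis unfolding F_def by (rule tendsto_mult_right_zero)
  qed
  have sum_b: "(\<Sum>j\<in>#z. b j) = (\<Sum>j\<in>#z. w j) + K * real (size z)" for z
    by (induction z) (simp_all add: b_def one_vec_def algebra_simps)
  have sum_b_le: "0 \<le> (\<Sum>j\<in>#z. b j)" "(\<Sum>j\<in>#z. b j) \<le> 2 * K * real (size z)" for z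
  proof -
    show "0 \<le> (\<Sum>j\<in>#z. b j)" using b0 by (induction z) auto
    show "(\<Sum>j\<in>#z. b j) \<le> 2 * K * real (size z)"
      by (induction z) (use b1 in \<open>auto simp: algebra_simps intro: add_mono\<close>)
  qed
  have close: "(\<lambda>n. measure (generation off n {#i#})
      {z. \<bar>R ^ n * (\<Sum>j\<in>#z. b j) - \<kappa> * (R ^ n * real (size z))\<bar> > e}) \<longlonglongrightarrow> 0" if "e > 0" for e
  proof (rule tendsto_in_prob_if_exp_tendsto[OF exp_difference_limit[OF LF b b0, folded \<kappa>_def]
        _ _ _ _ _ tail F0 that])
    show "0 \<le> R ^ n * (\<Sum>j\<in>#z. b j)" for n z using sum_b_le R_pos by simp
    show "0 \<le> \<kappa> * (R ^ n * real (size z))" for n and z :: "nat multiset"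
      using \<kappa>' K R_pos by (simp add: \<kappa>_eq)
    show "R ^ n * (\<Sum>j\<in>#z. b j) \<le> (2 * K + \<kappa>) * (R ^ n * real (size z))" for n z
    proof -
      have "R ^ n * (\<Sum>j\<in>#z. b j) \<le> R ^ n * (2 * K * real (size z))"
        using sum_b_le R_pos by (intro mult_left_mono) auto
      also have "\<dots> \<le> R ^ n * (2 * K * real (size z)) + \<kappa> * (R ^ n * real (size z))"
        using \<kappa>' K R_pos by (simp add: \<kappa>_eq)
      finally show ?thesis by (simp add: algebra_simps)
    qed
    show "\<kappa> * (R ^ n * real (size z)) \<le> (2 * K + \<kappa>) * (R ^ n * real (size z))" for n and z :: "nat multiset"
      using K R_pos by (intro mult_right_mono) auto
    show "0 \<le> 2 * K + \<kappa>" using \<kappa>' K by (simp add: \<kappa>_eq)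
  qed
  have "(\<lambda>n. measure (generation off n {#i#}) {z. R ^ n * (\<Sum>j\<in>#z. w j) > x}) \<longlonglongrightarrow> F (x / \<kappa>')"
  proof (rule slutsky_tail[where T = "\<lambda>n z. \<kappa>' * (R ^ n * real (size z))" and F = "\<lambda>y. F (y / \<kappa>')"])
    fix y :: real assume y: "y > 0"
    have "{z :: nat multiset. y < \<kappa>' * (R ^ n * real (size z))} = {z. y / \<kappa>' < R ^ n * real (size z)}" for n
      using \<kappa>' by (auto simp: field_simps)
    thus "(\<lambda>n. measure (generation off n {#i#}) {z. y < \<kappa>' * (R ^ n * real (size z))}) \<longlonglongrightarrow> F (y / \<kappa>')"
      using tail[of "y / \<kappa>'"] y \<kappa>' by simp
  next
    have "m * (amplitude one_vec * R / (1 - R)) \<noteq> 0" using A1 m_pos R_pos R_less_1 by simp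
    thus "isCont (\<lambda>y. F (y / \<kappa>')) x"
      unfolding F_def using \<kappa>' by (intro continuous_intros) auto
  next
    fix e :: real assume "e > 0"
    have "R ^ n * (\<Sum>j\<in>#z. w j) - \<kappa>' * (R ^ n * real (size z)) =
        R ^ n * (\<Sum>j\<in>#z. b j) - \<kappa> * (R ^ n * real (size z))" for n z
      by (simp add: \<kappa>_eq sum_b algebra_simps)
    thus "(\<lambda>n. measure (generation off n {#i#})
        {z. e < \<bar>R ^ n * (\<Sum>j\<in>#z. w j) - \<kappa>' * (R ^ n * real (size z))\<bar>}) \<longlonglongrightarrow> 0"
      using close[OF \<open>e > 0\<close>] by simp
  qed (fact x)
  also have "x / \<kappa>' / (m * (amplitude one_vec * R / (1 - R))) = x * (1 - R) / (R * m * amplitude w)"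
    using A A1 m_pos R_pos R_less_1 by (simp add: \<kappa>'_def divide_simps)
  hence "F (x / \<kappa>') = (1 - R) / R * right_vec i * exp (- (x * (1 - R) / (R * m * amplitude w)))"
    by (simp only: F_def)
  finally show ?thesis .
qed

end

section \<open>The Malthusian parameter\<close>

context lf_parameters
begin

text \<open>Writes a sublevel set of the extended-valued \<open>f\<close> as an intersection of
  closed polynomial conditions.\<close>

lemma lf_f_le_iff:
  assumes "0 \<le> s" "0 \<le> r"
  shows "lf_f H g s \<le> ennreal r \<longleftrightarrow> (\<forall>N. (\<Sum>n<N. lf_d H g (Suc n) * s ^ Suc n) \<le> r)"
  unfolding lf_f_def suminf_eq_SUP SUP_le_iff
  using assms lf_d_unit_interval(1)
  by (simp add: sum_ennreal sum_nonneg del: power_Suc)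

lemma lf_f_mono:
  assumes "0 \<le> s" "s \<le> t"
  shows "lf_f H g s \<le> lf_f H g t"
  unfolding lf_f_def
proof (rule suminf_le)
  show "ennreal (lf_d H g (Suc n) * s ^ Suc n) \<le> ennreal (lf_d H g (Suc n) * t ^ Suc n)" for n
    using assms lf_d_unit_interval(1) by (intro ennreal_leI mult_left_mono power_mono)
qed auto

lemma lf_f_eq_iff_sums:
  assumes "0 \<le> s" "0 \<le> r"
  shows "lf_f H g s = ennreal r \<longleftrightarrow> (\<lambda>n. lf_d H g (Suc n) * s ^ Suc n) sums r"
proof -
  have nn: "0 \<le> lf_d H g (Suc n) * s ^ Suc n" for n
    using assms lf_d_unit_interval(1)[of "Suc n"] by simp
  show ?thesis
  proof
    assume "lf_f H g s = ennreal r"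
    hence "(\<Sum>n. ennreal (lf_d H g (Suc n) * s ^ Suc n)) \<noteq> top" by (simp add: lf_f_def)
    with nn have "summable (\<lambda>n. lf_d H g (Suc n) * s ^ Suc n)" by (rule summable_suminf_not_top)
    then obtain r' where r': "(\<lambda>n. lf_d H g (Suc n) * s ^ Suc n) sums r'" by (auto simp: summable_def)
    have "0 \<le> r'" using sums_le[OF nn sums_zero r'] by simp
    moreover have "lf_f H g s = ennreal r'" unfolding lf_f_def using nn r' by (rule suminf_ennreal_eq)
    ultimately show "(\<lambda>n. lf_d H g (Suc n) * s ^ Suc n) sums r"
      using r' \<open>lf_f H g s = ennreal r\<close> assms by simp
  qed (use suminf_ennreal_eq[OF nn] in \<open>simp add: lf_f_def\<close>)
qed

text \<open>Equal values at s < t make the nonnegative terms d_n (t^n - s^n) sum to 0, so all d_n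
  vanish and so does \<open>f\<close>. In this form it excludes a second root for every positive
  \<open>r\<close>.\<close>

lemma malthusian_root_unique:
  assumes "lf_f H g s = ennreal r" "lf_f H g t = ennreal r" "0 \<le> s" "s < t"
  shows "r \<le> 0"
proof (rule ccontr)
  assume r: "\<not> r \<le> 0"
  have s: "(\<lambda>n. lf_d H g (Suc n) * s ^ Suc n) sums r"
    and t: "(\<lambda>n. lf_d H g (Suc n) * t ^ Suc n) sums r"
    using assms r by (simp_all add: lf_f_eq_iff_sums[symmetric] del: power_Suc)
  have lt: "s ^ Suc n < t ^ Suc n" for n using assms by (intro power_strict_mono) auto
  have 0: "(\<lambda>n. lf_d H g (Suc n) * (t ^ Suc n - s ^ Suc n)) sums 0"
    using sums_diff[OF t s] by (simp add: right_diff_distrib)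
  have "0 \<le> lf_d H g (Suc n) * (t ^ Suc n - s ^ Suc n)" for n
    using lf_d_unit_interval(1)[of "Suc n"] lt[of n] by (intro mult_nonneg_nonneg) auto
  hence zero: "lf_d H g (Suc n) * (t ^ Suc n - s ^ Suc n) = 0" for n
    using suminf_eq_zero_iff[OF sums_summable[OF 0]] sums_unique[OF 0] by simp
  have "lf_d H g (Suc n) = 0" for n using zero[of n] lt[of n] by (simp del: power_Suc)
  thus False using s r by (simp add: sums_iff)
qed

lemma lf_d_nonzero:
  assumes "lf_f_at_Rf H g > 0"
  obtains k where "lf_d H g (Suc k) > 0"
proof (rule ccontr)
  assume "\<not> thesis"
  hence "lf_d H g (Suc k) = 0" for k
    using that lf_d_unit_interval(1)[of "Suc k"] by (metis less_eq_real_def)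
  hence "lf_f H g = (\<lambda>_. 0)" by (simp add: lf_f_def fun_eq_iff)
  hence "lf_f_at_Rf H g = 0" by (simp add: lf_f_at_Rf_def tendsto_Lim)
  thus False using assms by simp
qed

text \<open>The root is the largest \<open>s\<close> with \<open>f s \<le> r\<close>: the power series \<open>f\<close> is lower semicontinuous
  everywhere and continuous inside its interval of convergence.\<close>
lemma malthusian_root_exists:
  assumes r: "r > 0" and large: "lf_f_at_Rf H g \<ge> ennreal r"
  obtains s where "0 < s" "lf_f H g s = ennreal r"
proof -
  have "lf_f_at_Rf H g > 0" using less_le_trans[OF _ large, of 0] r by simp
  then obtain k where k: "lf_d H g (Suc k) > 0" by (rule lf_d_nonzero)
  define S where "S = {s. 0 \<le> s \<and> lf_f H g s \<le> ennreal r}"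
  have S_eq: "S = {0..} \<inter> (\<Inter>N. {s. (\<Sum>n<N. lf_d H g (Suc n) * s ^ Suc n) \<le> r})"
    using lf_f_le_iff r by (auto simp: S_def simp del: power_Suc)
  have "closed S"
    unfolding S_eq
    by (intro closed_Int closed_INT ballI closed_Collect_le continuous_intros closed_atLeast)
  have "0 \<in> S" using r by (simp add: S_def lf_f_def)
  \<comment> \<open>For s > 1 one term with a positive coefficient suffices: it is at least
    \<open>lf_d H g (Suc k) * s\<close> and at most \<open>r\<close>.\<close>
  have "bdd_above S"
  proof (rule bdd_aboveI[where M = "max 1 (r / lf_d H g (Suc k))"])
    fix s assume s: "s \<in> S"
    show "s \<le> max 1 (r / lf_d H g (Suc k))"
    proof (cases "s \<le> 1")
      case False
      have nn: "0 \<le> lf_d H g (Suc n) * s ^ Suc n" for n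
        using False lf_d_unit_interval(1)[of "Suc n"] by simp
      have "lf_d H g (Suc k) * s \<le> lf_d H g (Suc k) * s ^ Suc k"
        using False k self_le_power[of s "Suc k"] by (intro mult_left_mono) auto
      also have "\<dots> \<le> (\<Sum>n<Suc k. lf_d H g (Suc n) * s ^ Suc n)"
        using nn by (intro member_le_sum) auto
      also have "\<dots> \<le> r" using s S_eq by blast
      finally show ?thesis using k by (simp add: field_simps le_max_iff_disj)
    qed simp
  qed
  define t where "t = Sup S"
  have "t \<in> S" unfolding t_def
    using \<open>0 \<in> S\<close> \<open>bdd_above S\<close> \<open>closed S\<close> by (intro closed_contains_Sup) auto
  hence t: "0 \<le> t" "lf_f H g t \<le> ennreal r" by (auto simp: S_def)
  have max: "s \<le> t" if "s \<in> S" for s unfolding t_def using that \<open>bdd_above S\<close> by (rule cSup_upper)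
  have eq: "lf_f H g t = ennreal r"
  proof (rule ccontr)
    assume "lf_f H g t \<noteq> ennreal r"
    with t have less: "lf_f H g t < ennreal r" by simp
    \<comment> \<open>If t < R_f, then \<open>f\<close> is continuous slightly beyond t and some s >
      t still belongs to \<open>S\<close>. Otherwise R_f \<le> t, and monotonicity gives f(R_f)
      \<le> f(t) < r, against \<open>large\<close>.\<close>
    show False
    proof (cases "ennreal t < lf_Rf H g")
      case True
      then obtain e where e: "ennreal t < e" "e < lf_Rf H g" using dense by blast
      then obtain u where u: "0 \<le> u" "e = ennreal u" by (cases e) auto
      have "t < u" using e t u by (simp add: ennreal_less_iff)
      have "lf_f H g u \<noteq> top"
      proof
        assume "lf_f H g u = top"
        hence "lf_Rf H g \<le> ennreal u"
          unfolding lf_Rf_def using \<open>t < u\<close> t by (intro Inf_lower) auto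
        thus False using e u by simp
      qed
      hence "summable (\<lambda>n. lf_d H g (Suc n) * u ^ Suc n)"
        unfolding lf_f_def using u lf_d_unit_interval(1) by (intro summable_suminf_not_top) auto
      from summable_mult[OF this, of "inverse u"]
      have sum_u: "summable (\<lambda>n. lf_d H g (Suc n) * u ^ n)"
        using \<open>t < u\<close> t by (simp add: field_simps)
      \<comment> \<open>One factor s is pulled out so that the remaining power series starts with
        exponent 0.\<close>
      define G where "G s = s * (\<Sum>n. lf_d H g (Suc n) * s ^ n)" for s
      have G: "lf_f H g s = ennreal (G s)" "0 \<le> G s" if "0 \<le> s" "s < u" for s
      proof -
        have sm: "summable (\<lambda>n. lf_d H g (Suc n) * s ^ n)"
          using powser_inside[OF sum_u, of s] that by simp
        hence "(\<lambda>n. lf_d H g (Suc n) * s ^ Suc n) sums G s"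
          using sums_mult[OF summable_sums[OF sm], of s] by (simp add: G_def mult_ac)
        moreover show "0 \<le> G s"
          unfolding G_def using that lf_d_unit_interval(1) sm
          by (intro mult_nonneg_nonneg suminf_nonneg) auto
        ultimately show "lf_f H g s = ennreal (G s)" using that by (subst lf_f_eq_iff_sums) auto
      qed
      have "isCont G t"
        unfolding G_def using \<open>t < u\<close> t
        by (intro continuous_intros isCont_powser[OF sum_u]) auto
      hence "(G \<longlongrightarrow> G t) (at_right t)"
        unfolding isCont_def by (rule filterlim_mono) (auto simp: at_le)
      moreover have "G t < r" using less G[of t] t \<open>t < u\<close> by (simp add: ennreal_less_iff)
      ultimately have "eventually (\<lambda>s. G s < r) (at_right t)" by (rule order_tendstoD)
      moreover have "eventually (\<lambda>s. s \<in> {t<..<u}) (at_right t)"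
        using \<open>t < u\<close> by (rule eventually_at_right_real)
      ultimately have "eventually (\<lambda>s. G s < r \<and> s \<in> {t<..<u}) (at_right t)"
        by (rule eventually_conj)
      then obtain s where s: "G s < r" "t < s" "s < u"
        using eventually_happens[of _ "at_right t"] by auto
      hence "s \<in> S" using G[of s] t r by (simp add: S_def ennreal_leI)
      thus False using max[of s] s by simp
    next
      case False
      then obtain v where v: "0 \<le> v" "lf_Rf H g = ennreal v" "v \<le> t"
        using t by (cases "lf_Rf H g") (auto simp: not_less ennreal_le_iff top_unique)
      hence "lf_f_at_Rf H g = lf_f H g v" by (simp add: lf_f_at_Rf_def)
      also have "\<dots> \<le> lf_f H g t" using v by (intro lf_f_mono) auto
      finally show False using large less by simp
    qed
  qed
  moreover have "t \<noteq> 0" using eq r by (auto simp: lf_f_def)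
  ultimately show ?thesis using that[of t] t by simp
qed

lemma ennreal_mult_eq_1_iff: "ennreal m * X = 1 \<longleftrightarrow> X = ennreal (1 / m)"
proof
  assume *: "ennreal m * X = 1"
  hence "X \<noteq> top" using m_pos by (auto simp: ennreal_mult_top)
  then obtain x where x: "0 \<le> x" "X = ennreal x" by (cases X) auto
  with * m_pos have "ennreal (m * x) = ennreal 1" by (simp add: ennreal_mult)
  hence "m * x = 1" using m_pos x by (subst (asm) ennreal_inj) auto
  thus "X = ennreal (1 / m)" using x m_pos by (simp add: field_simps)
qed (use m_pos in \<open>simp flip: ennreal_mult ennreal_1\<close>)

text \<open>Existence and uniqueness of the root s together make the description in
  \<open>lf_alpha\<close> denote - ln s.\<close>

lemma lf_R_root:
  assumes "lf_f_at_Rf H g \<ge> ennreal (1 / m)"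
  shows "lf_f H g (lf_R H g m) = ennreal (1 / m)"
proof -
  have "1 / m > 0" using m_pos by simp
  then obtain s where s: "0 < s" "lf_f H g s = ennreal (1 / m)"
    using malthusian_root_exists[OF _ assms] by blast
  have "(THE a. ennreal m * lf_f H g (exp (- a)) = 1) = - ln s"
  proof (rule the_equality)
    show "ennreal m * lf_f H g (exp (- (- ln s))) = 1"
      using s by (simp add: ennreal_mult_eq_1_iff)
    fix a assume "ennreal m * lf_f H g (exp (- a)) = 1"
    hence a: "lf_f H g (exp (- a)) = ennreal (1 / m)" by (simp add: ennreal_mult_eq_1_iff)
    have "exp (- a) = s"
      using malthusian_root_unique[OF a s(2)] malthusian_root_unique[OF s(2) a] s(1) \<open>1 / m > 0\<close>
      by (cases "exp (- a)" s rule: linorder_cases) auto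
    thus "a = - ln s" by (metis ln_exp minus_minus)
  qed
  thus ?thesis using assms s by (simp add: lf_R_def lf_alpha_def)
qed

text \<open>Finiteness of beta excludes the case f(R_f) < 1/m, where alpha is - \<infinity>, so
  \<open>lf_R\<close> is a genuine root.\<close>

lemma lf_supercriticalI:
  assumes "lf_beta H g m < \<infinity>" and "lf_rho H g m > 1"
  shows "lf_supercritical H g m (lf_R H g m)"
proof unfold_locales
  have large: "lf_f_at_Rf H g \<ge> ennreal (1 / m)"
    using assms(1) by (auto simp: lf_beta_def split: if_splits)
  show R: "0 < lf_R H g m" by (simp add: lf_R_def)
  show "lf_R H g m < 1" using assms(2) R unfolding lf_rho_def
    by (metis inverse_inverse_eq inverse_less_1_iff less_imp_inverse_less inverse_1 zero_less_one)
  have "(\<lambda>n. lf_d H g (Suc n) * lf_R H g m ^ Suc n) sums (1 / m)"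
    using lf_R_root[OF large] R m_pos by (subst (asm) lf_f_eq_iff_sums) auto
  from sums_mult[OF this, of m] show "(\<lambda>n. m * lf_d H g (Suc n) * lf_R H g m ^ Suc n) sums 1"
    using m_pos by (simp add: mult_ac)
qed

end

section \<open>Identification of beta, u and v\<close>

context lf_supercritical
begin

lemma enn2real_lf_beta:
  assumes "R = lf_R H g m" and "lf_beta H g m < \<infinity>"
  shows "enn2real (lf_beta H g m) = beta"
proof -
  have large: "lf_f_at_Rf H g \<ge> ennreal (1 / m)"
    using assms(2) by (auto simp: lf_beta_def split: if_splits)
  have "exp (- real_of_ereal (lf_alpha H g m) * real (Suc n)) = R ^ Suc n" for n
    unfolding assms(1) lf_R_def by (subst mult.commute, subst exp_of_nat_mult) simp
  hence "lf_beta H g m = ennreal m * (\<Sum>n. ennreal (real (Suc n) * lf_d H g (Suc n) * R ^ Suc n))"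
    using large by (simp add: lf_beta_def)
  also have "(\<lambda>n. real (Suc n) * lf_d H g (Suc n) * R ^ Suc n) sums (inverse m * beta)"
  proof -
    have "inverse m * (real (Suc n) * (m * lf_d H g (Suc n) * R ^ Suc n)) =
        real (Suc n) * lf_d H g (Suc n) * R ^ Suc n" for n
      using m_pos by (simp del: of_nat_Suc power_Suc)
    thus ?thesis
      using sums_mult[OF summable_sums[OF summable_beta], of "inverse m"] by (simp only: beta_def)
  qed
  hence "(\<Sum>n. ennreal (real (Suc n) * lf_d H g (Suc n) * R ^ Suc n)) = ennreal (inverse m * beta)"
    using R_pos lf_d_unit_interval(1) by (intro suminf_ennreal_eq) auto
  also have "ennreal m * ennreal (inverse m * beta) = ennreal beta"
    using m_pos beta_pos by (simp flip: ennreal_mult)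
  finally show ?thesis using beta_pos by simp
qed

lemma right_vec_eq: "right_vec i = (\<Sum>k. R ^ Suc k * mat_vec (mat_pow H (Suc k)) one_vec i)"
  unfolding right_vec_def mat_vec_mat_pow[OF substochastic_H bounded_one_vec] ..

lemma right_vec_pos:
  assumes "mat_vec H one_vec i > 0"
  shows "right_vec i > 0"
  unfolding right_vec_def
proof (rule suminf_pos2[where i = 0])
  show "summable (\<lambda>k. R ^ Suc k * (mat_vec H ^^ Suc k) one_vec i)"
    using summable_right_vec by (rule summable_rabs_cancel)
  show "0 \<le> R ^ Suc k * (mat_vec H ^^ Suc k) one_vec i" for k
    using R_pos mat_vec_pow_one_unit_interval(1)[of "Suc k" i] by (simp del: funpow.simps)
qed (use assms R_pos in simp)

text \<open>The sums over generations and types must be exchanged. Normalising R^k to the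
  probability vector (1 - R) R^k and taking g H^k as the rows of a substochastic matrix
  \<open>Y\<close> reduces this to \<open>vec_mat_swap\<close>.\<close>

lemma dot_left_vec:
  assumes "R = lf_R H g m" and w: "bounded (range w)"
  shows "dot (lf_v H g m) w = m / (1 + m) * (beta * amplitude w)"
proof -
  define Y where "Y k = vec_mat g (mat_pow H k)" for k
  define h where "h k = (1 - R) * R ^ k" for k
  have h_sums: "h sums 1"
    using sums_mult[OF geometric_sums[of R], of "1 - R"] R_pos R_less_1 by (simp add: h_def[abs_def])
  have h: "subprob_vec h"
    using h_sums R_pos R_less_1 by (auto simp: subprob_vec_def sums_iff h_def)
  have Y: "substochastic Y"
    unfolding substochastic_iff Y_def
    using subprob_vec_vec_mat[OF g_subprob substochastic_mat_pow[OF substochastic_H]] by simp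
  have YW: "mat_vec Y w k = dot g ((mat_vec H ^^ k) w)" for k
    unfolding mat_vec_eq_dot Y_def vec_mat_swap(2)[OF g_subprob substochastic_mat_pow[OF substochastic_H] w]
      mat_vec_mat_pow[OF substochastic_H w] ..
  have sY: "summable (\<lambda>k. R ^ k * Y k j)" for j
    using summable_mult[OF vec_mat_swap(3)[OF h Y w, of j], of "inverse (1 - R)"] R_less_1
    by (simp add: h_def mult.assoc)
  have sW: "summable (\<lambda>k. R ^ k * dot g ((mat_vec H ^^ k) w))"
  proof -
    obtain C where C: "\<And>i. \<bar>w i\<bar> \<le> C" using bounded_rangeE[OF w] by blast
    have "bounded (range (mat_vec Y w))"
      using bounded_mat_vec[OF Y C] by (rule bounded_rangeI)
    from summable_mult[OF dot_summable(2)[OF h this], of "inverse (1 - R)"] show ?thesis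
      using R_less_1 by (simp add: h_def mult.assoc YW)
  qed
  have "lf_v H g m j = m / (1 + m) * (vec_mat h Y j / (1 - R))" for j
    using suminf_mult[OF sY, of "1 - R" j] R_less_1
    by (simp add: lf_v_def vec_mat_def[of h] h_def Y_def assms(1) mult.assoc)
  hence "dot (lf_v H g m) w = (\<Sum>j. m / (1 + m) / (1 - R) * (vec_mat h Y j * w j))"
    by (simp add: dot_def field_simps)
  also have "\<dots> = m / (1 + m) / (1 - R) * dot (vec_mat h Y) w"
    unfolding dot_def by (rule suminf_mult[OF vec_mat_swap(1)[OF h Y w]])
  also have "dot (vec_mat h Y) w = dot h (mat_vec Y w)" by (rule vec_mat_swap(2)[OF h Y w])
  also have "\<dots> = (1 - R) * (\<Sum>k. R ^ k * dot g ((mat_vec H ^^ k) w))"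
    using suminf_mult[OF sW, of "1 - R"] by (simp add: dot_def[of h] h_def YW mult.assoc)
  also have "(\<Sum>k. R ^ k * dot g ((mat_vec H ^^ k) w)) = beta * amplitude w"
    using beta_pos by (simp add: amplitude_def)
  finally show ?thesis using R_less_1 by simp
qed

end

text \<open>A zero row of \<open>A\<close> stays zero in every power with positive exponent.\<close>

lemma irreducible_mat_nonzero_row:
  assumes "irreducible_mat A"
  obtains j where "A i j \<noteq> 0"
proof (rule ccontr)
  assume "\<not> thesis"
  hence 0: "A i j = 0" for j using that by blast
  obtain n where n: "n \<ge> 1" "mat_pow A n i i > 0" using assms by (auto simp: irreducible_mat_def)
  then obtain l where "n = Suc l" by (cases n) auto
  thus False using n 0 by (simp add: mat_mult_def)
qed

theorem proposition11:
  fixes H :: "nat \<Rightarrow> nat \<Rightarrow> real" and g :: "nat \<Rightarrow> real" and m :: real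
    and M :: "'w measure"
    and off :: "nat \<Rightarrow> nat multiset pmf"
    and Z :: "nat \<Rightarrow> 'w \<Rightarrow> nat multiset"
  assumes "substochastic H" and "prob_vec g" and "m > 0"
    and "multitype_bgw M off Z"
    and "\<And>i. has_LF (off i) (H i) g m"
    and "AE \<omega> in M. \<exists>i. Z 0 \<omega> = {#i#}"
    and "irreducible_mat (mean_mat off)" and "aperiodic_mat (mean_mat off)"
    and "lf_beta H g m < \<infinity>"
    and "lf_rho H g m > 1"
  shows "\<forall>i. \<P>(\<omega> in M. Z 0 \<omega> = {#i#}) > 0 \<longrightarrow>
     (\<lambda>n. \<P>(\<omega> in M. Z n \<omega> \<noteq> {#} \<bar> Z 0 \<omega> = {#i#})) \<longlonglongrightarrow>
       (lf_rho H g m - 1) * inverse (1 + m) * enn2real (lf_beta H g m) * lf_u H g m i \<and>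
     (\<forall>w. bounded (range w) \<and> dot (lf_v H g m) w > 0 \<longrightarrow>
       (let c = (1 + m) * inverse (enn2real (lf_beta H g m)) * dot (lf_v H g m) w in
        \<forall>x>0. (\<lambda>n. \<P>(\<omega> in M. (\<Sum>j\<in>#Z n \<omega>. w j) > lf_rho H g m ^ n * x \<bar>
                               Z n \<omega> \<noteq> {#} \<and> Z 0 \<omega> = {#i#})) \<longlonglongrightarrow>
                 exp (- x * (lf_rho H g m - 1) / c)))"
proof (intro allI impI)
  fix i assume start: "\<P>(\<omega> in M. Z 0 \<omega> = {#i#}) > 0"
  define R where "R = lf_R H g m"
  interpret lf_parameters H g m by unfold_locales (fact assms)+
  interpret lf_supercritical H g m R
    unfolding R_def using assms(9,10) by (rule lf_supercriticalI)
  interpret multitype_bgw M off Z by fact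
  note LF = assms(5)
  have \<beta>: "enn2real (lf_beta H g m) = beta" using R_def assms(9) by (rule enn2real_lf_beta)
  have \<rho>: "lf_rho H g m = 1 / R" by (simp add: lf_rho_def R_def inverse_eq_divide)
  have u: "lf_u H g m i = (1 + m) / beta * right_vec i"
    unfolding lf_u_def \<beta> R_def[symmetric] right_vec_eq ..
  let ?q = "\<lambda>n. generation off n {#i#}"
  have joint: "\<P>(\<omega> in M. Z n \<omega> \<in> B \<and> Z 0 \<omega> = {#i#}) =
      \<P>(\<omega> in M. Z 0 \<omega> = {#i#}) * measure (?q n) B" for n B
    using cond_prob_start[OF start, of n B] start by (simp add: cond_prob_def field_simps)
  have surv: "\<P>(\<omega> in M. Z n \<omega> \<noteq> {#} \<bar> Z 0 \<omega> = {#i#}) = measure (?q n) {z. z \<noteq> {#}}" for n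
    using cond_prob_start[OF start, of n "{z. z \<noteq> {#}}"] by simp
  \<comment> \<open>Otherwise row \<open>i\<close> of \<open>H\<close>, and with it row
    \<open>i\<close> of M = H + m H 1 g, would be zero, against irreducibility. Positivity makes the
    limiting survival probability nonzero, so the conditional law may be obtained by
    division.\<close>
  have "mat_vec H one_vec i > 0"
  proof -
    obtain j where j: "mean_mat off i j \<noteq> 0" using irreducible_mat_nonzero_row[OF assms(7)] .
    have "mat_vec H one_vec i \<noteq> 0"
    proof
      assume 0: "mat_vec H one_vec i = 0"
      have "H i j \<le> suminf (H i)"
        using H_row[of i] sum_le_suminf[of "H i" "{j}"] by (auto simp: subprob_vec_def)
      hence "H i j = 0" using 0 H_row[of i] by (auto simp: mat_vec_def one_vec_def subprob_vec_def intro: antisym)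
      thus False using j 0 mean_mat_linear_fractional(2)[where off = off and i = i and j = j, OF assms(1-3) LF] by simp
    qed
    thus ?thesis using mat_vec_pow_one_unit_interval(1)[of 1 i] by simp
  qed
  hence U: "right_vec i > 0" by (rule right_vec_pos)
  show "(\<lambda>n. \<P>(\<omega> in M. Z n \<omega> \<noteq> {#} \<bar> Z 0 \<omega> = {#i#})) \<longlonglongrightarrow>
       (lf_rho H g m - 1) * inverse (1 + m) * enn2real (lf_beta H g m) * lf_u H g m i \<and>
     (\<forall>w. bounded (range w) \<and> dot (lf_v H g m) w > 0 \<longrightarrow>
       (let c = (1 + m) * inverse (enn2real (lf_beta H g m)) * dot (lf_v H g m) w in
        \<forall>x>0. (\<lambda>n. \<P>(\<omega> in M. (\<Sum>j\<in>#Z n \<omega>. w j) > lf_rho H g m ^ n * x \<bar>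
                               Z n \<omega> \<noteq> {#} \<and> Z 0 \<omega> = {#i#})) \<longlonglongrightarrow>
                 exp (- x * (lf_rho H g m - 1) / c)))"
    unfolding Let_def
  proof (intro conjI allI impI)
    have "(lf_rho H g m - 1) * inverse (1 + m) * enn2real (lf_beta H g m) * lf_u H g m i =
        (1 - R) / R * right_vec i"
      unfolding \<rho> \<beta> u using m_pos beta_pos R_pos by (simp add: divide_simps)
    thus "(\<lambda>n. \<P>(\<omega> in M. Z n \<omega> \<noteq> {#} \<bar> Z 0 \<omega> = {#i#})) \<longlonglongrightarrow>
       (lf_rho H g m - 1) * inverse (1 + m) * enn2real (lf_beta H g m) * lf_u H g m i"
      unfolding surv using survival_limit[where off = off and i = i, OF LF] by simp
  next
    fix w :: "nat \<Rightarrow> real" and x :: real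
    assume w: "bounded (range w) \<and> dot (lf_v H g m) w > 0" and x: "x > 0"
    have v: "dot (lf_v H g m) w = m / (1 + m) * (beta * amplitude w)"
      using R_def w by (intro dot_left_vec) auto
    hence "0 < (m / (1 + m) * beta) * amplitude w" using w by (simp add: mult.assoc)
    moreover have "0 < m / (1 + m) * beta" using m_pos beta_pos by simp
    ultimately have A: "amplitude w > 0" by (rule zero_less_mult_pos)
    have c: "- x * (lf_rho H g m - 1) / ((1 + m) * inverse (enn2real (lf_beta H g m)) * dot (lf_v H g m) w) =
        - (x * (1 - R) / (R * m * amplitude w))"
    proof -
      have cw: "(1 + m) * inverse beta * (m / (1 + m) * (beta * amplitude w)) = m * amplitude w"
        using m_pos beta_pos by (simp add: divide_simps)
      show ?thesis unfolding \<rho> \<beta> v cw using R_pos m_pos A by (simp add: divide_simps algebra_simps)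
    qed
    have P: "\<P>(\<omega> in M. (\<Sum>j\<in>#Z n \<omega>. w j) > lf_rho H g m ^ n * x \<bar> Z n \<omega> \<noteq> {#} \<and> Z 0 \<omega> = {#i#}) =
        measure (?q n) {z. R ^ n * (\<Sum>j\<in>#z. w j) > x} / measure (?q n) {z. z \<noteq> {#}}" for n
    proof -
      have gt: "a > lf_rho H g m ^ n * x \<longleftrightarrow> R ^ n * a > x" for a
        using R_pos by (simp add: \<rho> field_simps)
      \<comment> \<open>Survival is implied by the event on the left: on extinction the weighted sum
        is 0, which does not exceed the positive \<open>x\<close>.\<close>
      have num: "\<P>(\<omega> in M. (\<Sum>j\<in>#Z n \<omega>. w j) > lf_rho H g m ^ n * x \<and> Z n \<omega> \<noteq> {#} \<and> Z 0 \<omega> = {#i#}) =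
          \<P>(\<omega> in M. Z n \<omega> \<in> {z. R ^ n * (\<Sum>j\<in>#z. w j) > x} \<and> Z 0 \<omega> = {#i#})"
        unfolding gt using x by (intro arg_cong[where f = prob]) auto
      have den: "\<P>(\<omega> in M. Z n \<omega> \<noteq> {#} \<and> Z 0 \<omega> = {#i#}) =
          \<P>(\<omega> in M. Z 0 \<omega> = {#i#}) * measure (?q n) {z. z \<noteq> {#}}"
        using joint[of n "{z. z \<noteq> {#}}"] by simp
      show ?thesis unfolding cond_prob_def num joint den using start by simp
    qed
    show "(\<lambda>n. \<P>(\<omega> in M. (\<Sum>j\<in>#Z n \<omega>. w j) > lf_rho H g m ^ n * x \<bar> Z n \<omega> \<noteq> {#} \<and> Z 0 \<omega> = {#i#}))
        \<longlonglongrightarrow> exp (- x * (lf_rho H g m - 1) /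
          ((1 + m) * inverse (enn2real (lf_beta H g m)) * dot (lf_v H g m) w))"
      unfolding P c
      using tendsto_divide[OF functional_tail_limit[where off = off and i = i, OF LF _ A x] survival_limit[where off = off and i = i, OF LF]] U R_pos R_less_1 w
      by simp
  qed
qed

end
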